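(* Let $V_{i'}=\sum_j[g_{i',j}]_+^2$ for every level $i'$ (Setting (Q)), assume the regularity conditions (R1)–(R5) listed in the context, let level $i$ satisfy $V_i(z^\star_{\mathrm{lex}})=0$, and let $\lambda^\star(w_{-i})>0$ denote the limiting multipliers of its boundary-binding hinges for $w_{-i}$ in a compact set $K\subset\mathbb R_{++}^{L-1}$; let $z_{\mathrm{loc}}=z_{\mathrm{loc}}(w_i,w_{-i})$ be the local minimizer branch described in the context. Assume moreover that levels already violated at $z^\star_{\mathrm{lex}}$ are separated from their compliance thresholds by a positive margin. Then there exist uniform constants $C_{g,i},C_{V,i}\ge0$ and $\overline w_i<\infty$ such that, for $w_{-i}\in K$ and $w_i\ge\overline w_i$, $$\max_{j\in\mathcal B}|g_{i,j}(z_{\mathrm{loc}})|\le\frac{\|\lambda^\star(w_{-i})\|_\infty}{2w_i}+\frac{C_{g,i}}{w_i^2},\qquad V_i(z_{\mathrm{loc}})\le\frac{\|\lambda^\star(w_{-i})\|_2^2}{4w_i^2}+\frac{C_{V,i}}{w_i^3}.$$ Consequently, sufficient finite thresholds are $$w_i\ge\max\Bigl\{\overline w_i,\ \frac{\|\lambda^\star(w_{-i})\|_\infty}{\epsilon_i},\ \sqrt{\frac{2C_{g,i}}{\epsilon_i}}\Bigr\}\ \text{ for } |g_{i,j}|\le\epsilon_i\ (j\in\mathcal B,\text{ at } z_{\mathrm{loc}}),$$ $$w_i\ge\max\Bigl\{\overline w_i,\ \frac{\|\lambda^\star(w_{-i})\|_2}{\sqrt{2\epsilon_i}},\ \Bigl(\frac{2C_{V,i}}{\epsilon_i}\Bigr)^{1/3}\Bigr\}\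 \text{ for } V_i\le\epsilon_i\ (\text{at } z_{\mathrm{loc}}).$$ As $\epsilon_i\downarrow0$, the leading scalings are $\Theta(\epsilon_i^{-1})$ for raw-constraint tolerance and $\Theta(\epsilon_i^{-1/2})$ for violation-functional tolerance.
   Context: Control problem: $x_{k+1}=f(x_k,u_k)$ is a discrete-time system over a horizon of $N$ steps, $x_k\in\mathbb R^n$, $u_k\in\mathbb R^m$; a trajectory is $z=(x_{0:N},u_{0:N-1})\in\mathbb R^d$, $d=n(N+1)+mN$. The dynamics-feasible set is $\mathcal Z=\{z\in\mathbb R^d: x_{k+1}=f(x_k,u_k),\ x_0=\bar x_0,\ u_k\in\mathcal U_{\mathrm{hard}}\}$, with given initial state $\bar x_0$ and a set $\mathcal U_{\mathrm{hard}}$ of physical actuator limits. The performance objective is $J(z)=\sum_{k=0}^{N-1}\ell(x_k,u_k)+\ell_f(x_N)$ with stage cost $\ell$ and terminal cost $\ell_f$. There are $L$ priority levels, level $1$ having the highest priority, with rule constraints $g_{i,j}(z)\le0$, $j=1,\dots,m_i$, at level $i$. Write $[a]_+=\max(0,a)$, $\mathbb R_{++}=(0,\infty)$, and $V_i(z)=\sum_{j=1}^{m_i}[g_{i,j}(z)]_+^2$ (squared hinges); in Setting (Q) each $V_i$ is continuously differentiable. Lexicographic cascade: $\mathcal F_0=\mathcal Z$ and, for $i=1,\dots,L$, $V_i^\star=\min_{z\in\mathcal F_{i-1}}V_i(z)$, $\mathcal F_i=\{z\in\mathcal F_{i-1}:V_i(z)=V_i^\star\}$; the lexicographic optimum is $z^\star:=z^\star_{\mathrm{lex}}\in\arg\min_{z\in\mathcal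 F_L}J(z)$. The weighted-sum problem is $\min_{z\in\mathcal Z}J(z)+\sum_iw_iV_i(z)$, $w\in\mathbb R_{++}^L$. Assumptions adopted throughout: (A1) $\mathcal Z$ is compact, the cascade minima are attained, $\arg\min_{\mathcal F_L}J$ is non-empty, and the weighted-sum problem has a minimizer for every $w\in\mathbb R_{++}^L$; (A2) $z^\star_{\mathrm{lex}}$ is unique and its image $(V_1^\star,\dots,V_L^\star,J(z^\star))$ is uniquely determined; (A3) $\mathcal Z$, each $g_{i,j}$ and $J$ are convex. Fix level $i$ with $V_i(z^\star)=0$, and write $w=(w_i,w_{-i})$, $w_{-i}\in\mathbb R_{++}^{L-1}$ being the other weights. Put $\mathcal B=\{j:g_{i,j}(z^\star)=0\}$ (boundary-binding hinges of level $i$), $\eta=1/w_i$, $\Psi(z;w_{-i})=J(z)+\sum_{i'\ne i}w_{i'}V_{i'}(z)$, and $F_w(z)=\Psi(z;w_{-i})+w_iV_i(z)$. $G(z)$ stacks the gradients $\nabla g_{i,j}(z)$, $j\in\mathcal B$, as rows, and $G=G(z^\star)$. The limit problem is $(\mathrm P_\infty)$: $\min_z\Psi(z;w_{-i})$ subject to $g_{i,j}(z)\le0$, $j\in\mathcal B$; its multipliers $\lambda^\star(w_{-i})$ at $z^\star$ are the limiting multipliers. The solution path is the path $\eta\mapsto(z(\eta),\lambda(\eta))$ with $z(0)=z^\star$, $\lambda(0)=\lambda^\star(w_{-i})$ of solutions of $\nabla\Psi(z;w_{-i})+G(z)^\top\lambda=0$, $g_{i,j}(z)=\tfrac{\eta}{2}\lambda_j$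 ($j\in\mathcal B$). Regularity conditions. (R1) Stable sign classes: on a neighbourhood of $z^\star$ intersected with the solution path, every hinge outside $\mathcal B$ retains its sign class (strictly violated, boundary-binding or strictly satisfied, i.e. the sign of the constraint function) while each hinge in $\mathcal B$ passes from binding to strictly violated, so that $\Psi$ is twice continuously differentiable there along the branch. (R2) Linear independence: the gradients $\nabla g_{i,j}(z^\star)$, $j\in\mathcal B$, are nonzero and linearly independent. (R3)–(R5) Regular limit problem: for every $w_{-i}$ in the compact set $K$, $z^\star$ is the locally unique solution of $(\mathrm P_\infty)$, with unique multipliers $\lambda^\star(w_{-i})>0$, second-order sufficiency on the tangent space $\ker G$ (the Hessian at $z^\star$ of the Lagrangian $\Psi(z;w_{-i})+\sum_{j\in\mathcal B}\lambda_j^\star g_{i,j}(z)$ is positive definite on $\ker G$), and strict complementarity. Local branch: under these assumptions, for every $w_{-i}\in K$ and all sufficiently large finite $w_i$ (uniformly over $K$), $z_{\mathrm{loc}}(w_i,w_{-i})$ is the locally unique strict local minimizer of $F_w$ near $z^\star$, namely the point $z(\eta)$ of the solution path at $\eta=1/w_i$. Compliance thresholds: for a tolerance vector $\boldsymbol\epsilon=(\epsilon_1,\dots,\epsilon_L)>0$, the compliance vector is $b_{\boldsymbol\epsilon}(z)=(\mathbb 1[V_{i'}(z)\le\epsilon_{i'}])_{i'}$, so $\epsilon_{i'}$ is the compliance threshold of level $i'$. Scope declared by the paper for its local $\ell_2$ development: the proof is stated for $z^\star\in\operatorname{int}\mathcal Z$; if a fixed set of smooth hard constraints is active, the same argument applies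 in local coordinates on their active manifold under joint linear independence of the constraint gradients (LICQ) and second-order sufficiency; no claim is made across active-set changes. *)

theory Defs
  imports "HOL-Analysis.Analysis" "HOL-Library.Landau_Symbols"
begin

section \<open>The control problem\<close>

text \<open>
  The horizon is \<open>N = CARD('N)\<close>, so a trajectory consists of \<open>N + 1\<close> states in \<open>\<real>\<^sup>n\<close> and
  \<open>N\<close> inputs in \<open>\<real>\<^sup>m\<close>; the type is a Euclidean space of dimension \<open>n(N+1) + mN\<close>.
  On a finite type \<^const>\<open>from_nat_into\<close> \<^const>\<open>UNIV\<close> is a bijection from \<open>{..<CARD}\<close>,
  which labels the coordinates by time.
\<close>

type_synonym ('n, 'm, 'N) trajectory = "((real ^ 'n) ^ ('N option)) \<times> ((real ^ 'm) ^ 'N)"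

definition state_at :: "('n::finite, 'm::finite, 'N::finite) trajectory \<Rightarrow> nat \<Rightarrow> real ^ 'n" where
  "state_at z k = fst z $ from_nat_into UNIV k"

definition input_at :: "('n::finite, 'm::finite, 'N::finite) trajectory \<Rightarrow> nat \<Rightarrow> real ^ 'm" where
  "input_at z k = snd z $ from_nat_into UNIV k"

definition dynamics_feasible ::
  "(real ^ 'n \<Rightarrow> real ^ 'm \<Rightarrow> real ^ 'n) \<Rightarrow> real ^ 'n \<Rightarrow> (real ^ 'm) set
    \<Rightarrow> ('n::finite, 'm::finite, 'N::finite) trajectory set" where
  "dynamics_feasible f x0 Uhard =
     {z. state_at z 0 = x0 \<and>
         (\<forall>k<CARD('N). state_at z (Suc k) = f (state_at z k) (input_at z k) \<and> input_at z k \<in> Uhard)}"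

definition performance ::
  "(real ^ 'n \<Rightarrow> real ^ 'm \<Rightarrow> real) \<Rightarrow> (real ^ 'n \<Rightarrow> real)
    \<Rightarrow> ('n::finite, 'm::finite, 'N::finite) trajectory \<Rightarrow> real" where
  "performance stage final z =
     (\<Sum>k<CARD('N). stage (state_at z k) (input_at z k)) + final (state_at z CARD('N))"


section \<open>Violation functionals, lexicographic cascade, weighted sum\<close>

text \<open>
  The priority levels form a finite linearly ordered type \<open>'l\<close> (so \<open>L = CARD('l)\<close>), the least
  element having the highest priority.  Level \<open>i\<close> has the constraints \<open>g i j \<le> 0\<close>, \<open>1 \<le> j \<le> m i\<close>.
\<close>

definition violation :: "('l \<Rightarrow> nat \<Rightarrow> 'z \<Rightarrow> real) \<Rightarrow> ('l \<Rightarrow> nat) \<Rightarrow> 'l \<Rightarrow> 'z \<Rightarrow> real" where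
  "violation g m i z = (\<Sum>j=1..m i. (max 0 (g i j z))\<^sup>2)"

definition argmin_on :: "('z \<Rightarrow> real) \<Rightarrow> 'z set \<Rightarrow> 'z set" where
  "argmin_on \<phi> S = {z \<in> S. \<forall>y\<in>S. \<phi> z \<le> \<phi> y}"

text \<open>
  Successive minimisation over the levels in \<open>I\<close>, highest priority first:
  \<open>\<F>\<^sub>i\<close> is the cascade over \<open>{..i}\<close>, \<open>\<F>\<^sub>i\<^sub>-\<^sub>1\<close> the one over \<open>{..<i}\<close>, and \<open>\<F>\<^sub>L\<close> the one over \<open>UNIV\<close>.
\<close>

definition cascade :: "('l::linorder \<Rightarrow> 'z \<Rightarrow> real) \<Rightarrow> 'z set \<Rightarrow> 'l set \<Rightarrow> 'z set" where
  "cascade V Z I = fold (\<lambda>i. argmin_on (V i)) (sorted_list_of_set I) Z"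

definition weighted_sum ::
  "('z \<Rightarrow> real) \<Rightarrow> ('l::finite \<Rightarrow> 'z \<Rightarrow> real) \<Rightarrow> real ^ 'l \<Rightarrow> 'z \<Rightarrow> real" where
  "weighted_sum J V w z = J z + (\<Sum>i\<in>UNIV. w $ i * V i z)"

text \<open>
  The vector \<open>w\<^sub>-\<^sub>i\<close> of the weights of the other levels is represented by a vector of
  \<open>\<real>\<^sup>L\<close> whose (unused) \<open>i\<close>-th component is 0.
\<close>

definition other_weights :: "'l::finite \<Rightarrow> (real ^ 'l) set" where
  "other_weights i = {w. w $ i = 0 \<and> (\<forall>i'. i' \<noteq> i \<longrightarrow> 0 < w $ i')}"

definition Psi ::
  "('z \<Rightarrow> real) \<Rightarrow> ('l::finite \<Rightarrow> 'z \<Rightarrow> real) \<Rightarrow> 'l \<Rightarrow> real ^ 'l \<Rightarrow> 'z \<Rightarrow> real" where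
  "Psi J V i w z = J z + (\<Sum>i'\<in>UNIV - {i}. w $ i' * V i' z)"

definition penalised ::
  "('z \<Rightarrow> real) \<Rightarrow> ('l::finite \<Rightarrow> 'z \<Rightarrow> real) \<Rightarrow> 'l \<Rightarrow> real \<Rightarrow> real ^ 'l \<Rightarrow> 'z \<Rightarrow> real" where
  "penalised J V i wi w z = Psi J V i w z + wi * V i z"


section \<open>Gradients, Hessians and local minimisers\<close>

definition grad :: "('z::euclidean_space \<Rightarrow> real) \<Rightarrow> 'z \<Rightarrow> 'z" where
  "grad \<phi> z = (THE D. GDERIV \<phi> z :> D)"

definition hess :: "('z::euclidean_space \<Rightarrow> real) \<Rightarrow> 'z \<Rightarrow> 'z \<Rightarrow> 'z" where
  "hess \<phi> z = frechet_derivative (grad \<phi>) (at z)"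

definition C1 :: "('z::euclidean_space \<Rightarrow> real) \<Rightarrow> bool" where
  "C1 \<phi> \<longleftrightarrow> (\<forall>z. \<phi> differentiable (at z)) \<and> continuous_on UNIV (grad \<phi>)"

text \<open>
  Twice continuously differentiable at the points of \<open>S\<close>.  For open \<open>S\<close> this is the usual notion;
  for a curve \<open>S\<close> the Hessian is only required to exist, and to be continuous, along the curve.
\<close>

definition C2_along :: "('z::euclidean_space \<Rightarrow> real) \<Rightarrow> 'z set \<Rightarrow> bool" where
  "C2_along \<phi> S \<longleftrightarrow>
     (\<exists>U. open U \<and> S \<subseteq> U \<and> (\<forall>z\<in>U. \<phi> differentiable (at z))) \<and>
     (\<forall>z\<in>S. grad \<phi> differentiable (at z)) \<and>
     (\<forall>v. continuous_on S (\<lambda>z. hess \<phi> z v))"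

definition local_min_on :: "('z::topological_space \<Rightarrow> real) \<Rightarrow> 'z set \<Rightarrow> 'z \<Rightarrow> bool" where
  "local_min_on \<phi> M z \<longleftrightarrow> z \<in> M \<and> (\<exists>U. open U \<and> z \<in> U \<and> (\<forall>y\<in>M \<inter> U. \<phi> z \<le> \<phi> y))"

definition strict_local_min_on :: "('z::topological_space \<Rightarrow> real) \<Rightarrow> 'z set \<Rightarrow> 'z \<Rightarrow> bool" where
  "strict_local_min_on \<phi> M z \<longleftrightarrow>
     z \<in> M \<and> (\<exists>U. open U \<and> z \<in> U \<and> (\<forall>y\<in>M \<inter> U. y \<noteq> z \<longrightarrow> \<phi> z < \<phi> y))"


section \<open>Active hard constraints\<close>

text \<open>
  Here \<open>h l\<close>, \<open>l \<in> A\<close>, are the smooth hard constraints (valid on \<open>Z\<close>) that are active at \<open>zs\<close>;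
  near \<open>zs\<close> their common zero set, the active manifold, is contained in \<open>Z\<close>.
  For \<open>A = {}\<close> the condition says exactly \<open>zs \<in> interior Z\<close>.  The initial condition and
  the dynamics are such constraints (equality constraints, \<open>h l = 0\<close> on all of \<open>Z\<close>): they make the
  interior of the dynamics-feasible set in the full trajectory space empty, so a nonempty \<open>A\<close> is
  needed to cover them.
\<close>

definition active_hard ::
  "'z::euclidean_space set \<Rightarrow> (nat \<Rightarrow> 'z \<Rightarrow> real) \<Rightarrow> nat set \<Rightarrow> 'z \<Rightarrow> bool" where
  "active_hard Z h A zs \<longleftrightarrow>
     finite A \<and> (\<forall>l\<in>A. h l zs = 0) \<and>
     (\<exists>W. open W \<and> zs \<in> W \<and>
        (\<forall>l\<in>A. C2_along (h l) W) \<and>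
        (\<forall>z\<in>Z \<inter> W. \<forall>l\<in>A. h l z \<le> 0) \<and>
        (\<forall>z\<in>W. (\<forall>l\<in>A. h l z = 0) \<longrightarrow> z \<in> Z))"

definition active_manifold :: "'z set \<Rightarrow> (nat \<Rightarrow> 'z \<Rightarrow> real) \<Rightarrow> nat set \<Rightarrow> 'z set" where
  "active_manifold Z h A = {z \<in> Z. \<forall>l\<in>A. h l z = 0}"


section \<open>Limit problem, solution path, regularity conditions\<close>

text \<open>
  In this section \<open>\<psi>\<close> is \<open>Psi J V i w\<close> and \<open>c j\<close> is \<open>g i j\<close>, \<open>j \<in> B\<close>.  For \<open>A = {}\<close> all terms in \<open>h\<close>
  and \<open>\<mu>\<close> disappear.
\<close>

definition binding :: "('l \<Rightarrow> nat \<Rightarrow> 'z \<Rightarrow> real) \<Rightarrow> ('l \<Rightarrow> nat) \<Rightarrow> 'l \<Rightarrow> 'z \<Rightarrow> nat set" where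
  "binding g m i zs = {j \<in> {1..m i}. g i j zs = 0}"

definition lagrangian ::
  "('z \<Rightarrow> real) \<Rightarrow> (nat \<Rightarrow> 'z \<Rightarrow> real) \<Rightarrow> nat set \<Rightarrow> (nat \<Rightarrow> 'z \<Rightarrow> real) \<Rightarrow> nat set
    \<Rightarrow> (nat \<Rightarrow> real) \<Rightarrow> (nat \<Rightarrow> real) \<Rightarrow> 'z \<Rightarrow> real" where
  "lagrangian \<psi> c B h A lam \<mu> z = \<psi> z + (\<Sum>j\<in>B. lam j * c j z) + (\<Sum>l\<in>A. \<mu> l * h l z)"

definition stationary ::
  "('z::euclidean_space \<Rightarrow> real) \<Rightarrow> (nat \<Rightarrow> 'z \<Rightarrow> real) \<Rightarrow> nat set \<Rightarrow> (nat \<Rightarrow> 'z \<Rightarrow> real) \<Rightarrow> nat set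
    \<Rightarrow> (nat \<Rightarrow> real) \<Rightarrow> (nat \<Rightarrow> real) \<Rightarrow> 'z \<Rightarrow> bool" where
  "stationary \<psi> c B h A lam \<mu> z \<longleftrightarrow>
     grad \<psi> z + (\<Sum>j\<in>B. lam j *\<^sub>R grad (c j) z) + (\<Sum>l\<in>A. \<mu> l *\<^sub>R grad (h l) z) = 0"

definition limit_feasible ::
  "'z set \<Rightarrow> (nat \<Rightarrow> 'z \<Rightarrow> real) \<Rightarrow> nat set \<Rightarrow> (nat \<Rightarrow> 'z \<Rightarrow> real) \<Rightarrow> nat set \<Rightarrow> 'z set" where
  "limit_feasible Z c B h A = {z \<in> active_manifold Z h A. \<forall>j\<in>B. c j z \<le> 0}"

text \<open>Linear independence, of the family of gradients, jointly with the active hard constraints.\<close>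

definition joint_LICQ ::
  "(nat \<Rightarrow> 'z::euclidean_space \<Rightarrow> real) \<Rightarrow> nat set \<Rightarrow> (nat \<Rightarrow> 'z \<Rightarrow> real) \<Rightarrow> nat set \<Rightarrow> 'z \<Rightarrow> bool" where
  "joint_LICQ c B h A zs \<longleftrightarrow>
     (\<forall>j\<in>B. grad (c j) zs \<noteq> 0) \<and>
     inj_on (case_sum (\<lambda>j. grad (c j) zs) (\<lambda>l. grad (h l) zs)) (B <+> A) \<and>
     independent (case_sum (\<lambda>j. grad (c j) zs) (\<lambda>l. grad (h l) zs) ` (B <+> A))"

text \<open>
  Regularity of the limit problem for one \<open>w\<^sub>-\<^sub>i\<close>: \<open>zs\<close> is the locally unique solution of the limit problem, \<open>lam\<close> (with
  \<open>\<mu>\<close>) is the unique multiplier vector, the Hessian of the Lagrangian is positive definite on the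
  tangent space, and strict complementarity holds.
\<close>

definition regular_limit ::
  "'z::euclidean_space set \<Rightarrow> ('z \<Rightarrow> real) \<Rightarrow> (nat \<Rightarrow> 'z \<Rightarrow> real) \<Rightarrow> nat set
    \<Rightarrow> (nat \<Rightarrow> 'z \<Rightarrow> real) \<Rightarrow> nat set \<Rightarrow> 'z \<Rightarrow> (nat \<Rightarrow> real) \<Rightarrow> bool" where
  "regular_limit Z \<psi> c B h A zs lam \<longleftrightarrow>
     strict_local_min_on \<psi> (limit_feasible Z c B h A) zs \<and>
     (\<exists>\<mu>. stationary \<psi> c B h A lam \<mu> zs \<and>
        (\<forall>lam' \<mu>'. (\<forall>j\<in>B. 0 \<le> lam' j) \<and> stationary \<psi> c B h A lam' \<mu>' zs \<longrightarrow>
           (\<forall>j\<in>B. lam' j = lam j) \<and> (\<forall>l\<in>A. \<mu>' l = \<mu> l)) \<and>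
        (\<forall>v. v \<noteq> 0 \<and> (\<forall>j\<in>B. grad (c j) zs \<bullet> v = 0) \<and> (\<forall>l\<in>A. grad (h l) zs \<bullet> v = 0) \<longrightarrow>
           0 < hess (lagrangian \<psi> c B h A lam \<mu>) zs v \<bullet> v)) \<and>
     (\<forall>j\<in>B. 0 < lam j)"

definition solution_path ::
  "('z::euclidean_space \<Rightarrow> real) \<Rightarrow> (nat \<Rightarrow> 'z \<Rightarrow> real) \<Rightarrow> nat set \<Rightarrow> (nat \<Rightarrow> 'z \<Rightarrow> real) \<Rightarrow> nat set
    \<Rightarrow> 'z \<Rightarrow> (nat \<Rightarrow> real) \<Rightarrow> real \<Rightarrow> (real \<Rightarrow> 'z) \<Rightarrow> (real \<Rightarrow> nat \<Rightarrow> real) \<Rightarrow> bool" where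
  "solution_path \<psi> c B h A zs lam \<eta>\<^sub>0 zp lp \<longleftrightarrow>
     continuous_on {0..\<eta>\<^sub>0} zp \<and> (\<forall>j\<in>B. continuous_on {0..\<eta>\<^sub>0} (\<lambda>\<eta>. lp \<eta> j)) \<and>
     zp 0 = zs \<and> (\<forall>j\<in>B. lp 0 j = lam j) \<and>
     (\<forall>\<eta>\<in>{0..\<eta>\<^sub>0}.
        (\<exists>\<mu>. stationary \<psi> c B h A (lp \<eta>) \<mu> (zp \<eta>)) \<and>
        (\<forall>l\<in>A. h l (zp \<eta>) = 0) \<and>
        (\<forall>j\<in>B. c j (zp \<eta>) = \<eta> / 2 * lp \<eta> j))"

text \<open>Stable sign classes along the solution path of one \<open>w\<^sub>-\<^sub>i\<close>; the sign class of a hinge is the \<^const>\<open>sgn\<close> of \<open>g\<close>.\<close>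

definition stable_signs ::
  "('l \<Rightarrow> nat \<Rightarrow> 'z::euclidean_space \<Rightarrow> real) \<Rightarrow> ('l \<Rightarrow> nat) \<Rightarrow> 'l \<Rightarrow> ('z \<Rightarrow> real) \<Rightarrow> 'z
    \<Rightarrow> real \<Rightarrow> (real \<Rightarrow> 'z) \<Rightarrow> bool" where
  "stable_signs g m i \<psi> zs \<eta>\<^sub>0 zp \<longleftrightarrow>
     (\<exists>U. open U \<and> zs \<in> U \<and>
        (\<forall>\<eta>\<in>{0<..\<eta>\<^sub>0}. zp \<eta> \<in> U \<longrightarrow>
           (\<forall>i'. \<forall>j\<in>{1..m i'}. \<not> (i' = i \<and> j \<in> binding g m i zs) \<longrightarrow>
              sgn (g i' j (zp \<eta>)) = sgn (g i' j zs)) \<and>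
           (\<forall>j\<in>binding g m i zs. 0 < g i j (zp \<eta>))) \<and>
        C2_along \<psi> (U \<inter> zp ` {0..\<eta>\<^sub>0}))"

text \<open>
  The local branch: for \<open>w\<^sub>i \<ge> 1/\<eta>\<^sub>0\<close> (uniformly in \<open>w\<^sub>-\<^sub>i \<in> K\<close>), \<open>zloc w\<^sub>i w\<^sub>-\<^sub>i\<close> is the point of the solution
  path at \<open>1/w\<^sub>i\<close>, a strict local minimiser of the penalised objective \<open>F wi w\<close> on \<open>M\<close>, and its only
  local minimiser near \<open>zs\<close>.
\<close>

definition local_branch ::
  "(real \<Rightarrow> 'w \<Rightarrow> 'z::euclidean_space \<Rightarrow> real) \<Rightarrow> 'z set \<Rightarrow> 'w set \<Rightarrow> 'z
    \<Rightarrow> real \<Rightarrow> ('w \<Rightarrow> real \<Rightarrow> 'z) \<Rightarrow> (real \<Rightarrow> 'w \<Rightarrow> 'z) \<Rightarrow> bool" where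
  "local_branch F M K zs \<eta>\<^sub>0 zp zloc \<longleftrightarrow>
     (\<forall>w\<in>K. \<exists>U. open U \<and> zs \<in> U \<and>
        (\<forall>wi\<ge>1 / \<eta>\<^sub>0.
           zloc wi w = zp w (1 / wi) \<and> zloc wi w \<in> U \<and>
           strict_local_min_on (F wi w) M (zloc wi w) \<and>
           (\<forall>y\<in>U. local_min_on (F wi w) M y \<longrightarrow> y = zloc wi w)))"


section \<open>Norms and thresholds\<close>

text \<open>The maximum norm of a family, 0 for the empty one; the Euclidean norm is \<^const>\<open>L2_set\<close>.\<close>

definition max_norm :: "(nat \<Rightarrow> real) \<Rightarrow> nat set \<Rightarrow> real" where
  "max_norm v B = Max (insert 0 ((\<lambda>j. \<bar>v j\<bar>) ` B))"

definition raw_threshold :: "real \<Rightarrow> real \<Rightarrow> (nat \<Rightarrow> real) \<Rightarrow> nat set \<Rightarrow> real \<Rightarrow> real" where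
  "raw_threshold wbar C lam B e = Max {wbar, max_norm lam B / e, sqrt (2 * C / e)}"

definition violation_threshold :: "real \<Rightarrow> real \<Rightarrow> (nat \<Rightarrow> real) \<Rightarrow> nat set \<Rightarrow> real \<Rightarrow> real" where
  "violation_threshold wbar C lam B e =
     Max {wbar, L2_set lam B / sqrt (2 * e), root 3 (2 * C / e)}"

end

theory Submission
  imports Defs
begin

text \<open>
  On the solution path a binding constraint has the value \<open>g\<^sub>j = (\<eta> / 2) \<lambda>\<^sub>j(\<eta>)\<close> with \<open>\<eta> = 1 / w\<^sub>i\<close>.
  Hence everything follows from \<open>\<lambda>(\<eta>) = \<lambda>\<^sup>\<star> + O(\<eta>)\<close>, with a constant that is the same for all
  weights \<open>w\<close> in \<open>K\<close>: multiplying by \<open>\<eta> / 2\<close> gives the raw-constraint estimate, and summing squares gives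
  the estimate of \<open>V\<^sub>i\<close>, since near the optimum every non-binding hinge of level \<open>i\<close> is inactive.

  The rate is not obtained from an implicit function theorem, which would produce one path for each \<open>w\<close> and
  leave open whether it is the given one, and for which second-order smoothness along the path alone
  is too weak.  Instead the stationarity equations at \<open>z(\<eta>)\<close> and at \<open>z\<^sup>\<star>\<close> are subtracted.
  The displacement \<open>v = z(\<eta>) - z\<^sup>\<star>\<close> and the multiplier increments \<open>d\<close> then solve the linearised
  Karush-Kuhn-Tucker system up to an error \<open>o(1) (\<bar>v\<bar> + \<bar>d\<bar>) + O(\<eta>)\<close>.  This linear saddle-point system is
  boundedly invertible, because the gradients are linearly independent and the Hessian of the Lagrangian is
  positive definite on their annihilator (\<open>saddle_point_estimate\<close>); the \<open>o(1)\<close> part of the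
  error is absorbed, and \<open>\<bar>v\<bar> + \<bar>d\<bar> = O(\<eta>)\<close> remains (\<open>stationary_perturbation\<close>).
  This argument needs \<open>z(\<eta>)\<close> to lie in a fixed neighbourhood of \<open>z\<^sup>\<star>\<close>, and a continuous path
  cannot leave it for small \<open>\<eta>\<close>, since inside the estimate is already stronger
  (\<open>continuous_confinement\<close>).

  Uniformity in \<open>w\<close> comes from linearity: the gradient of the Lagrangian, with its multipliers at
  \<open>z\<^sup>\<star>\<close> expressed through \<open>w\<close>, is a linear function of \<open>(1, w)\<close>.
  The members of the family with \<open>w \<in> K\<close> are therefore bounded combinations of finitely many
  functions that are differentiable at \<open>z\<^sup>\<star>\<close>, so that the remainder, the norm of the Hessian and its
  coercivity constant are uniform over the compact set (\<open>linear_family_uniformly_regular\<close>).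
\<close>

section \<open>Linear saddle-point systems and their perturbation\<close>

lemma biorthogonal_family:
  fixes a :: "'i \<Rightarrow> 'z::euclidean_space"
  assumes inj: "inj_on a I" and ind: "independent (a ` I)"
  obtains y where "\<forall>k\<in>I. \<forall>l\<in>I. y k \<bullet> a l = (if k = l then 1 else 0)"
proof -
  have "\<exists>x. \<forall>l\<in>I. x \<bullet> a l = (if k = l then 1 else 0)" if k: "k \<in> I" for k
  proof -
    obtain g :: "'z \<Rightarrow> real" where g: "linear g" "\<forall>x\<in>a ` I. g x = (if x = a k then 1 else 0)"
      using linear_independent_extend[OF ind, of "\<lambda>x. if x = a k then 1 else 0"] by blast
    have "adjoint g 1 \<bullet> a l = (if k = l then 1 else 0)" if "l \<in> I" for l
    proof -
      have "adjoint g 1 \<bullet> a l = g (a l)"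
        using adjoint_works[OF g(1), of "a l" 1] by (simp add: inner_commute)
      also have "\<dots> = (if k = l then 1 else 0)"
        using g(2) that k inj by (auto dest: inj_onD)
      finally show ?thesis .
    qed
    then show ?thesis by blast
  qed
  then have "\<exists>y. \<forall>k\<in>I. \<forall>l\<in>I. y k \<bullet> a l = (if k = l then 1 else 0)" by metis
  then show ?thesis using that by blast
qed

text \<open>
  A displacement with prescribed values \<open>a k \<bullet> v\<close> is a combination \<open>q\<close> of the dual vectors plus a
  vector \<open>u\<close> annihilated by all \<open>a k\<close>.  Testing \<open>H v + (\<Sum>k\<in>I. d k *\<^sub>R a k)\<close> with \<open>u\<close> removes the
  multiplier term and coercivity bounds \<open>u\<close>; then that sum, with \<open>H v\<close> known, bounds the multiplier term, whose
  coefficients are read off by the dual vectors.  The constant depends on \<open>H\<close> only through \<open>M\<close> and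
  \<open>\<alpha>\<close>, which makes it usable for a whole family of Hessians.
\<close>

lemma saddle_point_estimate:
  fixes a y :: "'i \<Rightarrow> 'z::euclidean_space"
  assumes fin: "finite I"
    and dual: "\<forall>k\<in>I. \<forall>l\<in>I. y k \<bullet> a l = (if k = l then 1 else 0)"
    and \<alpha>: "0 < \<alpha>" and M: "0 \<le> M"
  shows "\<exists>C>0. \<forall>H v d. linear H \<longrightarrow> (\<forall>x. norm (H x) \<le> M * norm x) \<longrightarrow>
       (\<forall>u. (\<forall>k\<in>I. a k \<bullet> u = 0) \<longrightarrow> \<alpha> * (norm u)\<^sup>2 \<le> H u \<bullet> u) \<longrightarrow>
       norm v + (\<Sum>k\<in>I. \<bar>d k\<bar>)
         \<le> C * (norm (H v + (\<Sum>k\<in>I. d k *\<^sub>R a k)) + (\<Sum>k\<in>I. \<bar>a k \<bullet> v\<bar>))"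
proof -
  define Y where "Y = (\<Sum>k\<in>I. norm (y k))"
  define P where "P = (1 + M * Y) / \<alpha> + Y"
  have Y: "0 \<le> Y" unfolding Y_def by (simp add: sum_nonneg)
  have yY: "norm (y k) \<le> Y" if "k \<in> I" for k
    unfolding Y_def using that fin by (intro member_le_sum) auto
  have P: "0 \<le> P" unfolding P_def using \<alpha> M Y by simp
  show ?thesis
  proof (intro exI[of _ "P + Y * (1 + M * P) + 1"] conjI allI impI)
    show "0 < P + Y * (1 + M * P) + 1" using P Y M by (simp add: add_nonneg_pos)
  next
    fix H :: "'z \<Rightarrow> 'z" and v d
    assume linH: "linear H" and HM': "\<forall>x. norm (H x) \<le> M * norm x"
      and coer: "\<forall>u. (\<forall>k\<in>I. a k \<bullet> u = 0) \<longrightarrow> \<alpha> * (norm u)\<^sup>2 \<le> H u \<bullet> u"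
    note HM = HM'[rule_format]
    define r where "r = (\<Sum>k\<in>I. d k *\<^sub>R a k)"
    define E where "E = norm (H v + r)"
    define \<tau> where "\<tau> = (\<Sum>k\<in>I. \<bar>a k \<bullet> v\<bar>)"
    define q where "q = (\<Sum>k\<in>I. (a k \<bullet> v) *\<^sub>R y k)"
    define u where "u = v - q"
    have E0: "0 \<le> E" and \<tau>0: "0 \<le> \<tau>" by (auto simp: E_def \<tau>_def sum_nonneg)
    have q: "norm q \<le> Y * \<tau>"
    proof -
      have "norm q \<le> (\<Sum>k\<in>I. \<bar>a k \<bullet> v\<bar> * Y)"
        unfolding q_def by (rule sum_norm_le) (simp add: mult_left_mono yY)
      then show ?thesis unfolding \<tau>_def sum_distrib_right[symmetric] by (simp only: mult.commute)
    qed
    have "a k \<bullet> q = a k \<bullet> v" if "k \<in> I" for k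
    proof -
      have "a k \<bullet> q = (\<Sum>l\<in>I. (a l \<bullet> v) * (y l \<bullet> a k))"
        by (simp add: q_def inner_sum_right inner_commute)
      also have "\<dots> = (\<Sum>l\<in>I. if l = k then a l \<bullet> v else 0)"
        by (rule sum.cong) (simp_all add: dual that)
      finally show ?thesis using fin that by simp
    qed
    then have ut: "\<forall>k\<in>I. a k \<bullet> u = 0" by (simp add: u_def inner_diff_right)
    have ru: "r \<bullet> u = 0" using ut by (simp add: r_def inner_sum_left)
    have Hu: "H u = (H v + r) - r - H q" using linH by (simp add: u_def linear_diff)
    have "\<alpha> * (norm u)\<^sup>2 \<le> H u \<bullet> u" using coer ut by blast
    also have "\<dots> = (H v + r) \<bullet> u - H q \<bullet> u" by (simp add: Hu inner_diff_left inner_add_left ru)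
    also have "\<dots> \<le> E * norm u + M * norm q * norm u"
    proof -
      have "(H v + r) \<bullet> u \<le> E * norm u" unfolding E_def by (rule norm_cauchy_schwarz)
      moreover have "- (H q \<bullet> u) \<le> norm (H q) * norm u"
        using Cauchy_Schwarz_ineq2[of "H q" u] by linarith
      moreover have "norm (H q) * norm u \<le> M * norm q * norm u"
        by (rule mult_right_mono[OF HM]) simp
      ultimately show ?thesis by linarith
    qed
    finally have "norm u * (\<alpha> * norm u) \<le> norm u * (E + M * norm q)"
      by (simp add: power2_eq_square algebra_simps)
    then have "\<alpha> * norm u \<le> E + M * norm q"
      using E0 M by (cases "norm u = 0") (auto simp: mult_le_cancel_left)
    also have "\<dots> \<le> E + M * (Y * \<tau>)" using q M by (simp add: mult_left_mono)
    also have "\<dots> \<le> (1 + M * Y) * (E + \<tau>)"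
      using E0 \<tau>0 M Y by (simp add: algebra_simps)
    finally have "norm u \<le> (1 + M * Y) / \<alpha> * (E + \<tau>)" using \<alpha> by (simp add: field_simps)
    moreover have "norm v \<le> norm u + norm q"
      using norm_triangle_ineq[of u q] by (simp add: u_def)
    moreover have "Y * \<tau> \<le> Y * (E + \<tau>)" using E0 Y by (simp add: mult_left_mono)
    ultimately have v: "norm v \<le> P * (E + \<tau>)"
      using q unfolding P_def by (simp add: algebra_simps)
    have "norm r \<le> E + norm (H v)"
      unfolding E_def using norm_triangle_ineq4[of "H v + r" "H v"] by simp
    also have "\<dots> \<le> E + M * (P * (E + \<tau>))"
      using HM[of v] mult_left_mono[OF v M] by linarith
    also have "\<dots> \<le> (1 + M * P) * (E + \<tau>)" using \<tau>0 by (simp add: algebra_simps)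
    finally have r: "norm r \<le> (1 + M * P) * (E + \<tau>)" .
    have "\<bar>d k\<bar> \<le> norm (y k) * norm r" if "k \<in> I" for k
    proof -
      have "y k \<bullet> r = (\<Sum>l\<in>I. if l = k then d l else 0)"
        unfolding r_def inner_sum_right by (rule sum.cong) (auto simp: dual that)
      then have "y k \<bullet> r = d k" using fin that by simp
      then show ?thesis using Cauchy_Schwarz_ineq2[of "y k" r] by simp
    qed
    then have "(\<Sum>k\<in>I. \<bar>d k\<bar>) \<le> Y * norm r"
      unfolding Y_def sum_distrib_right by (rule sum_mono)
    also have "\<dots> \<le> Y * ((1 + M * P) * (E + \<tau>))" by (rule mult_left_mono[OF r Y])
    finally have "norm v + (\<Sum>k\<in>I. \<bar>d k\<bar>) \<le> (P + Y * (1 + M * P)) * (E + \<tau>)"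
      using v by (simp add: algebra_simps)
    also have "\<dots> \<le> (P + Y * (1 + M * P) + 1) * (E + \<tau>)"
      using E0 \<tau>0 by (intro mult_right_mono) auto
    finally show "norm v + (\<Sum>k\<in>I. \<bar>d k\<bar>) \<le> (P + Y * (1 + M * P) + 1) *
        (norm (H v + (\<Sum>k\<in>I. d k *\<^sub>R a k)) + (\<Sum>k\<in>I. \<bar>a k \<bullet> v\<bar>))"
      by (simp add: E_def \<tau>_def r_def)
  qed
qed

lemma has_derivative_eventually_nhds:
  assumes "(f has_derivative f') (at x)" and "0 < e"
  shows "\<forall>\<^sub>F z in nhds x. norm (f z - f x - f' (z - x)) \<le> e * norm (z - x)"
proof -
  from assms obtain d where "d > 0"
      "\<forall>z. norm (z - x) < d \<longrightarrow> norm (f z - f x - f' (z - x)) \<le> e * norm (z - x)"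
    unfolding has_derivative_at_alt by blast
  then show ?thesis unfolding eventually_nhds_metric by (auto simp: dist_norm)
qed

text \<open>
  \<open>F s\<close> stands for the gradient of a Lagrangian with its multipliers fixed at their limit values, so that
  \<open>F s z + (\<Sum>k\<in>I. d k *\<^sub>R a k z)\<close> is the gradient for multipliers changed by \<open>d\<close>.
  Keeping \<open>a k\<close> at the new point in the term with \<open>d\<close> means that the multipliers need no a priori bound: in the error
  terms \<open>d\<close> only meets the small factors \<open>a k z - a k zs\<close> and \<open>\<eta>\<close>.
\<close>

lemma stationary_perturbation:
  fixes a :: "'i \<Rightarrow> 'z::euclidean_space \<Rightarrow> 'z" and c :: "'i \<Rightarrow> 'z \<Rightarrow> real"
    and F D :: "'s \<Rightarrow> 'z \<Rightarrow> 'z"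
  assumes fin: "finite I"
    and dual: "\<forall>k\<in>I. \<forall>l\<in>I. y k \<bullet> a l zs = (if k = l then 1 else 0)"
    and \<alpha>: "0 < \<alpha>" and M: "0 \<le> M" and \<Lambda>: "0 \<le> \<Lambda>"
    and lin: "\<And>s. s \<in> K \<Longrightarrow> linear (D s)"
    and bnd: "\<And>s x. s \<in> K \<Longrightarrow> norm (D s x) \<le> M * norm x"
    and coer: "\<And>s u. s \<in> K \<Longrightarrow> \<forall>k\<in>I. a k zs \<bullet> u = 0 \<Longrightarrow> \<alpha> * (norm u)\<^sup>2 \<le> D s u \<bullet> u"
    and unif: "\<And>e. 0 < e \<Longrightarrow>
      \<forall>\<^sub>F z in nhds zs. \<forall>s\<in>K. norm (F s z - D s (z - zs)) \<le> e * norm (z - zs)"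
    and cder: "\<And>k. k \<in> I \<Longrightarrow> (c k has_derivative (\<lambda>v. a k zs \<bullet> v)) (at zs)"
    and c0: "\<And>k. k \<in> I \<Longrightarrow> c k zs = 0"
    and acont: "\<And>k. k \<in> I \<Longrightarrow> isCont (a k) zs"
  obtains C \<eta>\<^sub>1 where "0 < C" "0 < \<eta>\<^sub>1"
    "\<forall>\<^sub>F z in nhds zs. \<forall>s\<in>K. \<forall>d. \<forall>\<eta>\<in>{0..\<eta>\<^sub>1}.
       F s z + (\<Sum>k\<in>I. d k *\<^sub>R a k z) = 0 \<longrightarrow> (\<forall>k\<in>I. \<bar>c k z\<bar> \<le> \<eta> * (\<Lambda> + \<bar>d k\<bar>)) \<longrightarrow>
       norm (z - zs) + (\<Sum>k\<in>I. \<bar>d k\<bar>) \<le> C * \<eta>"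
proof -
  note saddle = saddle_point_estimate[of I y "\<lambda>k. a k zs", OF fin dual \<alpha> M]
  obtain C\<^sub>0 where C0: "0 < C\<^sub>0" and est:
    "\<forall>H v d. linear H \<longrightarrow> (\<forall>x. norm (H x) \<le> M * norm x) \<longrightarrow>
       (\<forall>u. (\<forall>k\<in>I. a k zs \<bullet> u = 0) \<longrightarrow> \<alpha> * (norm u)\<^sup>2 \<le> H u \<bullet> u) \<longrightarrow>
       norm v + (\<Sum>k\<in>I. \<bar>d k\<bar>)
         \<le> C\<^sub>0 * (norm (H v + (\<Sum>k\<in>I. d k *\<^sub>R a k zs)) + (\<Sum>k\<in>I. \<bar>a k zs \<bullet> v\<bar>))"
    using saddle by (elim exE conjE)
  define n where "n = real (card I)"
  have n: "0 \<le> n" by (simp add: n_def)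
  \<comment> \<open>the total error is at most \<open>e * (n + 2)\<close> times the left-hand side,
     which after multiplication by \<open>C\<^sub>0\<close> is half of it\<close>
  define e where "e = 1 / (2 * C\<^sub>0 * (n + 2))"
  have e: "0 < e" and Ce: "C\<^sub>0 * (e * (n + 2)) = 1 / 2"
  proof -
    have "0 < C\<^sub>0 * (n + 2)" using C0 n by simp
    then show "0 < e" "C\<^sub>0 * (e * (n + 2)) = 1 / 2"
      unfolding e_def by (simp_all add: field_simps del: zero_less_mult_iff)
  qed
  have ev1: "\<forall>\<^sub>F z in nhds zs. \<forall>k\<in>I. \<bar>c k z - a k zs \<bullet> (z - zs)\<bar> \<le> e * norm (z - zs)"
    using has_derivative_eventually_nhds[OF cder e] c0
    by (auto intro!: eventually_ball_finite fin)
  have ev2: "\<forall>\<^sub>F z in nhds zs. \<forall>k\<in>I. norm (a k z - a k zs) \<le> e"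
  proof (intro eventually_ball_finite fin ballI)
    fix k assume "k \<in> I"
    then have "(a k \<longlongrightarrow> a k zs) (nhds zs)"
      using acont by (simp add: isCont_def tendsto_nhds_iff)
    from tendstoD[OF this e] show "\<forall>\<^sub>F z in nhds zs. norm (a k z - a k zs) \<le> e"
      by eventually_elim (simp add: dist_norm)
  qed
  show ?thesis
  proof
    show "0 < 2 * C\<^sub>0 * n * \<Lambda> + 1" using C0 n \<Lambda> by (simp add: add_nonneg_pos)
    show "0 < e" by (rule e)
    show "\<forall>\<^sub>F z in nhds zs. \<forall>s\<in>K. \<forall>d. \<forall>\<eta>\<in>{0..e}.
       F s z + (\<Sum>k\<in>I. d k *\<^sub>R a k z) = 0 \<longrightarrow> (\<forall>k\<in>I. \<bar>c k z\<bar> \<le> \<eta> * (\<Lambda> + \<bar>d k\<bar>)) \<longrightarrow>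
       norm (z - zs) + (\<Sum>k\<in>I. \<bar>d k\<bar>) \<le> (2 * C\<^sub>0 * n * \<Lambda> + 1) * \<eta>"
      using unif[OF e] ev1 ev2
    proof eventually_elim
      case (elim z)
      show ?case
      proof (intro ballI allI impI)
        fix s d \<eta> assume s: "s \<in> K" and \<eta>: "\<eta> \<in> {0..e}"
          and stat: "F s z + (\<Sum>k\<in>I. d k *\<^sub>R a k z) = 0"
          and cz: "\<forall>k\<in>I. \<bar>c k z\<bar> \<le> \<eta> * (\<Lambda> + \<bar>d k\<bar>)"
        define v where "v = z - zs"
        define \<Delta> where "\<Delta> = (\<Sum>k\<in>I. \<bar>d k\<bar>)"
        have \<Delta>: "0 \<le> \<Delta>" by (simp add: \<Delta>_def sum_nonneg)
        have "D s v + (\<Sum>k\<in>I. d k *\<^sub>R a k zs)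
            = - (F s z - D s v) - (\<Sum>k\<in>I. d k *\<^sub>R (a k z - a k zs))"
          using stat by (simp add: algebra_simps sum_subtractf)
        also have "norm \<dots> \<le> e * norm v + (\<Sum>k\<in>I. \<bar>d k\<bar> * e)"
        proof -
          have "norm (F s z - D s v) \<le> e * norm v" using elim(1) s by (simp add: v_def)
          moreover have "norm (\<Sum>k\<in>I. d k *\<^sub>R (a k z - a k zs)) \<le> (\<Sum>k\<in>I. \<bar>d k\<bar> * e)"
            by (rule sum_norm_le) (use elim(3) in \<open>simp add: mult_left_mono\<close>)
          ultimately show ?thesis
            using norm_triangle_ineq4[of "- (F s z - D s v)" "\<Sum>k\<in>I. d k *\<^sub>R (a k z - a k zs)"]
            by (simp only: norm_minus_cancel)
        qed
        finally have E: "norm (D s v + (\<Sum>k\<in>I. d k *\<^sub>R a k zs)) \<le> e * (norm v + \<Delta>)"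
          by (simp add: \<Delta>_def sum_distrib_left algebra_simps)
        have "(\<Sum>k\<in>I. \<bar>a k zs \<bullet> v\<bar>) \<le> (\<Sum>k\<in>I. \<eta> * \<Lambda> + e * \<bar>d k\<bar> + e * norm v)"
        proof (rule sum_mono)
          fix k assume k: "k \<in> I"
          have "\<bar>c k z - a k zs \<bullet> v\<bar> \<le> e * norm v" using elim(2) k by (simp add: v_def)
          moreover have "\<bar>c k z\<bar> \<le> \<eta> * \<Lambda> + \<eta> * \<bar>d k\<bar>" using cz k by (simp add: algebra_simps)
          moreover have "\<eta> * \<bar>d k\<bar> \<le> e * \<bar>d k\<bar>" using \<eta> by (simp add: mult_right_mono)
          ultimately show "\<bar>a k zs \<bullet> v\<bar> \<le> \<eta> * \<Lambda> + e * \<bar>d k\<bar> + e * norm v" by linarith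
        qed
        also have "\<dots> = n * \<Lambda> * \<eta> + e * \<Delta> + n * e * norm v"
          by (simp add: sum.distrib n_def \<Delta>_def sum_distrib_left)
        also have "\<dots> \<le> n * \<Lambda> * \<eta> + e * (n + 1) * (norm v + \<Delta>)"
          using \<Delta> e n by (simp add: algebra_simps)
        finally have "norm (D s v + (\<Sum>k\<in>I. d k *\<^sub>R a k zs)) + (\<Sum>k\<in>I. \<bar>a k zs \<bullet> v\<bar>)
            \<le> n * \<Lambda> * \<eta> + e * (n + 2) * (norm v + \<Delta>)"
          using E by (simp add: algebra_simps)
        then have "C\<^sub>0 * (norm (D s v + (\<Sum>k\<in>I. d k *\<^sub>R a k zs)) + (\<Sum>k\<in>I. \<bar>a k zs \<bullet> v\<bar>))
            \<le> C\<^sub>0 * (n * \<Lambda> * \<eta> + e * (n + 2) * (norm v + \<Delta>))"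
          using C0 by (intro mult_left_mono) auto
        moreover have "norm v + \<Delta>
            \<le> C\<^sub>0 * (norm (D s v + (\<Sum>k\<in>I. d k *\<^sub>R a k zs)) + (\<Sum>k\<in>I. \<bar>a k zs \<bullet> v\<bar>))"
          unfolding \<Delta>_def
          by (rule est[THEN spec[of _ "D s"], THEN spec[of _ v], THEN spec[of _ d],
                THEN mp, THEN mp, THEN mp]) (use lin[OF s] bnd[OF s] coer[OF s] in auto)
        ultimately have "norm v + \<Delta> \<le> C\<^sub>0 * (n * \<Lambda> * \<eta> + e * (n + 2) * (norm v + \<Delta>))"
          by linarith
        also have "\<dots> = C\<^sub>0 * n * \<Lambda> * \<eta> + C\<^sub>0 * (e * (n + 2)) * (norm v + \<Delta>)"
          by (simp add: algebra_simps)
        finally have "norm v + \<Delta> \<le> C\<^sub>0 * n * \<Lambda> * \<eta> + 1 / 2 * (norm v + \<Delta>)" unfolding Ce .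
        moreover have "x \<le> 2 * b" if "x \<le> b + 1 / 2 * x" for x b :: real using that by linarith
        ultimately have "norm v + \<Delta> \<le> 2 * (C\<^sub>0 * n * \<Lambda> * \<eta>)" by blast
        also have "\<dots> \<le> (2 * C\<^sub>0 * n * \<Lambda> + 1) * \<eta>" using \<eta> by (simp add: algebra_simps)
        finally show "norm (z - zs) + (\<Sum>k\<in>I. \<bar>d k\<bar>) \<le> (2 * C\<^sub>0 * n * \<Lambda> + 1) * \<eta>"
          by (simp add: v_def \<Delta>_def)
      qed
    qed
  qed
qed

section \<open>Uniformity over compact sets of parameters\<close>

text \<open>
  Differentiability at \<open>zs\<close> is assumed for the parameters in \<open>K\<close> only, and it extends to their span, but the
  unit vectors need not lie in that span.  A linear projection \<open>P\<close> onto the span repairs this: for \<open>s \<in> K\<close> the function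
  \<open>F s\<close> is the combination of the finitely many differentiable functions \<open>F (P b)\<close> with the
  coordinates \<open>s \<bullet> b\<close> as coefficients.
\<close>

lemma linear_family_uniformly_regular:
  fixes F :: "'s::euclidean_space \<Rightarrow> 'z::euclidean_space \<Rightarrow> 'z"
  assumes linF: "\<And>z. linear (\<lambda>s. F s z)" and K: "compact K"
    and diffF: "\<And>s. s \<in> K \<Longrightarrow> F s differentiable (at zs)"
    and T: "subspace T"
    and pos: "\<And>s u. s \<in> K \<Longrightarrow> u \<in> T \<Longrightarrow> u \<noteq> 0 \<Longrightarrow> 0 < frechet_derivative (F s) (at zs) u \<bullet> u"
  obtains \<alpha> M where "0 < \<alpha>" "0 \<le> M"
    "\<forall>s\<in>K. \<forall>u\<in>T. \<alpha> * (norm u)\<^sup>2 \<le> frechet_derivative (F s) (at zs) u \<bullet> u"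
    "\<forall>s\<in>K. \<forall>x. norm (frechet_derivative (F s) (at zs) x) \<le> M * norm x"
    "\<forall>e>0. \<forall>\<^sub>F z in nhds zs. \<forall>s\<in>K.
       norm (F s z - F s zs - frechet_derivative (F s) (at zs) (z - zs)) \<le> e * norm (z - zs)"
proof -
  have "\<exists>P\<in>{P. linear P}. range P \<subseteq> span K \<and> (\<forall>v\<in>span K. P v = v)"
    using linear_exists_left_inverse_on[of "\<lambda>x::'s. x" "span K"] by (auto simp: linear_ident)
  then obtain P :: "'s \<Rightarrow> 's" where P: "linear P" "\<And>s. P s \<in> span K" "\<And>s. s \<in> span K \<Longrightarrow> P s = s"
    by auto
  have "subspace {s. F s differentiable (at zs)}"
  proof (rule subspaceI)
    have "F 0 = (\<lambda>z. 0)" using linear_0[OF linF] by auto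
    then show "0 \<in> {s. F s differentiable (at zs)}" by simp
  next
    fix s t assume *: "s \<in> {s. F s differentiable (at zs)}" "t \<in> {s. F s differentiable (at zs)}"
    have "F (s + t) = (\<lambda>z. F s z + F t z)" using linear_add[OF linF] by auto
    with * show "s + t \<in> {s. F s differentiable (at zs)}" by (simp add: differentiable_add)
  next
    fix r s assume *: "s \<in> {s. F s differentiable (at zs)}"
    have "F (r *\<^sub>R s) = (\<lambda>z. r *\<^sub>R F s z)" using linear_cmul[OF linF] by auto
    with * show "r *\<^sub>R s \<in> {s. F s differentiable (at zs)}"
      by (simp add: differentiable_scaleR)
  qed
  then have span_diff: "F s differentiable (at zs)" if "s \<in> span K" for s
    using span_minimal[of K "{s. F s differentiable (at zs)}"] diffF that by auto
  define D where "D b = frechet_derivative (F (P b)) (at zs)" for b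
  have D: "(F (P b) has_derivative D b) (at zs)" for b
    unfolding D_def using span_diff P(2) frechet_derivative_works by blast
  have Fexp: "F s z = (\<Sum>b\<in>Basis. (s \<bullet> b) *\<^sub>R F (P b) z)" if "s \<in> K" for s z
  proof -
    have "linear (\<lambda>s. F (P s) z)" using linear_compose[OF P(1) linF] by (simp add: o_def)
    from linear_sum[OF this, of "\<lambda>b. (s \<bullet> b) *\<^sub>R b" Basis]
    have "F (P s) z = (\<Sum>b\<in>Basis. (s \<bullet> b) *\<^sub>R F (P b) z)"
      by (simp add: euclidean_representation linear_cmul[OF \<open>linear (\<lambda>s. F (P s) z)\<close>])
    then show ?thesis using P(3) that by (simp add: span_base)
  qed
  have Dexp: "frechet_derivative (F s) (at zs) = (\<lambda>x. \<Sum>b\<in>Basis. (s \<bullet> b) *\<^sub>R D b x)" if "s \<in> K" for s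
  proof -
    have "F s = (\<lambda>z. \<Sum>b\<in>Basis. (s \<bullet> b) *\<^sub>R F (P b) z)" using Fexp[OF that] by auto
    moreover have "((\<lambda>z. \<Sum>b\<in>Basis. (s \<bullet> b) *\<^sub>R F (P b) z) has_derivative
        (\<lambda>x. \<Sum>b\<in>Basis. (s \<bullet> b) *\<^sub>R D b x)) (at zs)"
      by (intro has_derivative_sum has_derivative_scaleR_right D)
    ultimately show ?thesis by (metis frechet_derivative_at)
  qed
  obtain R where R: "0 < R" "\<And>s. s \<in> K \<Longrightarrow> norm s \<le> R"
    using compact_imp_bounded[OF K] bounded_pos by blast
  have sR: "\<bar>s \<bullet> b\<bar> \<le> R" if "s \<in> K" "b \<in> Basis" for s b
    using Basis_le_norm[OF that(2), of s] R(2)[OF that(1)] by linarith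
  define M where "M = (\<Sum>b\<in>Basis. R * onorm (D b))"
  have blD: "bounded_linear (D b)" for b using D has_derivative_bounded_linear by blast
  obtain \<alpha> where \<alpha>: "0 < \<alpha>"
    "\<And>s u. s \<in> K \<Longrightarrow> u \<in> T \<Longrightarrow> norm u = 1 \<Longrightarrow> \<alpha> \<le> frechet_derivative (F s) (at zs) u \<bullet> u"
  proof (cases "K \<times> (T \<inter> sphere 0 1) = {}")
    case True
    show thesis by (rule that[of 1]) (use True in auto)
  next
    case False
    let ?S = "K \<times> (T \<inter> sphere 0 1)"
    let ?q = "\<lambda>p. (\<Sum>b\<in>Basis. (fst p \<bullet> b) *\<^sub>R D b (snd p)) \<bullet> snd p"
    have "compact ?S"
      by (intro compact_Times K closed_Int_compact closed_subspace T compact_sphere)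
    moreover have "continuous_on ?S ?q"
      by (intro continuous_intros bounded_linear.continuous_on[OF blD])
    ultimately have "\<exists>p\<in>?S. \<forall>p'\<in>?S. ?q p \<le> ?q p'"
      by (rule continuous_attains_inf[OF _ False])
    then obtain p where p: "p \<in> ?S" "\<And>p'. p' \<in> ?S \<Longrightarrow> ?q p \<le> ?q p'"
      by blast
    show thesis
    proof (rule that[of "?q p"])
      have "fst p \<in> K" "snd p \<in> T" "snd p \<noteq> 0" using p(1) by auto
      then show "0 < ?q p" using pos[of "fst p" "snd p"] by (simp add: Dexp)
    next
      fix s u assume "s \<in> K" "u \<in> T" "norm u = 1"
      then show "?q p \<le> frechet_derivative (F s) (at zs) u \<bullet> u"
        using p(2)[of "(s, u)"] Dexp[of s] by auto
    qed
  qed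
  show ?thesis
  proof (rule that; (intro ballI allI impI)?)
    show "0 < \<alpha>" by fact
    show "0 \<le> M" unfolding M_def using R blD by (intro sum_nonneg mult_nonneg_nonneg) (auto intro: onorm_pos_le)
  next
    fix s u assume s: "s \<in> K" and u: "u \<in> T"
    show "\<alpha> * (norm u)\<^sup>2 \<le> frechet_derivative (F s) (at zs) u \<bullet> u"
    proof (cases "u = 0")
      case True then show ?thesis by simp
    next
      case False
      define x where "x = (1 / norm u) *\<^sub>R u"
      have x: "x \<in> T" "norm x = 1" "u = norm u *\<^sub>R x"
        using False u T by (auto simp: x_def subspace_scale)
      have lin: "linear (frechet_derivative (F s) (at zs))"
        using diffF[OF s] by (rule linear_frechet_derivative)
      have "frechet_derivative (F s) (at zs) u \<bullet> u
          = (norm u)\<^sup>2 * (frechet_derivative (F s) (at zs) x \<bullet> x)"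
        by (subst (1 2) x(3)) (simp add: linear_cmul[OF lin] power2_eq_square)
      then show ?thesis using \<alpha>(2)[OF s x(1,2)] False by (simp add: mult_left_mono mult.commute)
    qed
  next
    fix s x assume s: "s \<in> K"
    have "norm (\<Sum>b\<in>Basis. (s \<bullet> b) *\<^sub>R D b x) \<le> (\<Sum>b\<in>Basis. R * onorm (D b) * norm x)"
    proof (rule sum_norm_le)
      fix b :: 's assume "b \<in> Basis"
      then have "\<bar>s \<bullet> b\<bar> * norm (D b x) \<le> R * (onorm (D b) * norm x)"
        using sR[OF s] R(1) onorm[OF blD] by (intro mult_mono) auto
      then show "norm ((s \<bullet> b) *\<^sub>R D b x) \<le> R * onorm (D b) * norm x" by simp
    qed
    then show "norm (frechet_derivative (F s) (at zs) x) \<le> M * norm x"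
      by (simp add: Dexp[OF s] M_def sum_distrib_right)
  next
    fix e :: real assume e: "0 < e"
    define n where "n = real (card (Basis :: 's set))"
    have n: "0 < n" by (simp add: n_def)
    define e' where "e' = e / (n * R)"
    have e': "0 < e'" using e n R by (simp add: e'_def)
    have "\<forall>\<^sub>F z in nhds zs. \<forall>b\<in>(Basis :: 's set).
        norm (F (P b) z - F (P b) zs - D b (z - zs)) \<le> e' * norm (z - zs)"
      by (intro eventually_ball_finite ballI has_derivative_eventually_nhds D e') simp
    then show "\<forall>\<^sub>F z in nhds zs. \<forall>s\<in>K.
       norm (F s z - F s zs - frechet_derivative (F s) (at zs) (z - zs)) \<le> e * norm (z - zs)"
    proof eventually_elim
      case (elim z)
      show ?case
      proof
        fix s assume s: "s \<in> K"
        have "F s z - F s zs - frechet_derivative (F s) (at zs) (z - zs)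
          = (\<Sum>b\<in>Basis. (s \<bullet> b) *\<^sub>R (F (P b) z - F (P b) zs - D b (z - zs)))"
          by (simp add: Fexp[OF s, of z] Fexp[OF s, of zs] Dexp[OF s] sum_subtractf
              scaleR_diff_right)
        also have "norm \<dots> \<le> (\<Sum>b\<in>(Basis :: 's set). R * (e' * norm (z - zs)))"
        proof (rule sum_norm_le)
          fix b :: 's assume b: "b \<in> Basis"
          show "norm ((s \<bullet> b) *\<^sub>R (F (P b) z - F (P b) zs - D b (z - zs)))
              \<le> R * (e' * norm (z - zs))"
            using sR[OF s b] R(1) elim b by (simp add: mult_mono)
        qed
        also have "\<dots> = e * norm (z - zs)" using n R by (simp add: n_def e'_def)
        finally show "norm (F s z - F s zs - frechet_derivative (F s) (at zs) (z - zs))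
            \<le> e * norm (z - zs)" .
      qed
    qed
  qed
qed

section \<open>Gradients and Lagrangians\<close>

lemma gradI:
  assumes "(\<phi> has_derivative (\<lambda>v. D \<bullet> v)) (at z)"
  shows "grad \<phi> z = D"
proof -
  have "GDERIV \<phi> z :> D" using assms by (simp add: gderiv_def inner_commute)
  moreover have "D' = D" if "GDERIV \<phi> z :> D'" for D'
  proof -
    have "(\<lambda>v. v \<bullet> D') = (\<lambda>v. D \<bullet> v)"
      using that assms unfolding gderiv_def by (rule has_derivative_unique)
    then show ?thesis by (metis inner_commute vector_eq_rdot)
  qed
  ultimately show ?thesis unfolding grad_def by blast
qed

lemma grad_has_derivative:
  fixes \<phi> :: "'z::euclidean_space \<Rightarrow> real"
  assumes "\<phi> differentiable (at z)"
  shows "(\<phi> has_derivative (\<lambda>v. grad \<phi> z \<bullet> v)) (at z)"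
proof -
  from assms obtain \<phi>' where \<phi>': "(\<phi> has_derivative \<phi>') (at z)" by (auto simp: differentiable_def)
  then have "linear \<phi>'" by (rule has_derivative_linear)
  then have "\<phi>' = (\<lambda>v. adjoint \<phi>' 1 \<bullet> v)"
    using adjoint_works[of \<phi>' _ 1] by (auto simp: inner_commute)
  with \<phi>' have "(\<phi> has_derivative (\<lambda>v. adjoint \<phi>' 1 \<bullet> v)) (at z)" by simp
  with gradI show ?thesis by metis
qed

lemma C2_alongD:
  assumes "C2_along \<phi> S" and "z \<in> S"
  shows "\<phi> differentiable (at z)" and "grad \<phi> differentiable (at z)"
  using assms unfolding C2_along_def by blast+

lemma stationary_Plus:
  assumes "finite B" "finite A"
  shows "stationary \<psi> c B h A lam \<mu> z \<longleftrightarrow>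
    grad \<psi> z + (\<Sum>k\<in>B <+> A. case_sum lam \<mu> k *\<^sub>R grad (case_sum c h k) z) = 0"
  using assms by (simp add: stationary_def sum.Plus add.assoc)

lemma lagrangian_Plus:
  assumes "finite B" "finite A"
  shows "lagrangian \<psi> c B h A lam \<mu> =
    (\<lambda>z. \<psi> z + (\<Sum>k\<in>B <+> A. case_sum lam \<mu> k * case_sum c h k z))"
  using assms by (auto simp: lagrangian_def sum.Plus add.assoc)

section \<open>The solution path stays within distance of order \<open>\<eta>\<close>\<close>

text \<open>
  A continuity argument: were the distance to \<open>q\<close> to exceed \<open>\<delta>\<close>, it would have to equal \<open>\<delta>\<close> somewhere, where the
  estimate limits it to \<open>\<delta> / 2\<close>.
\<close>

lemma continuous_confinement:
  fixes p :: "real \<Rightarrow> 'z::real_normed_vector"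
  assumes cont: "continuous_on {0..b} p" and p0: "p 0 = q" and C: "0 < C" and b: "2 * (C * b) \<le> \<delta>"
    and \<delta>: "0 < \<delta>"
    and est: "\<And>t. t \<in> {0..b} \<Longrightarrow> norm (p t - q) \<le> \<delta> \<Longrightarrow> norm (p t - q) \<le> C * t"
    and t: "t \<in> {0..b}"
  shows "norm (p t - q) \<le> C * t"
proof (rule est[OF t], rule ccontr)
  assume "\<not> norm (p t - q) \<le> \<delta>"
  moreover have "continuous_on {0..t} (\<lambda>x. norm (p x - q))"
    using t by (intro continuous_intros continuous_on_subset[OF cont]) auto
  ultimately obtain x where x: "0 \<le> x" "x \<le> t" "norm (p x - q) = \<delta>"
    using IVT'[of "\<lambda>x. norm (p x - q)" 0 \<delta> t] p0 \<delta> t by auto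
  then have "\<delta> \<le> C * x" using est[of x] t by simp
  also have "\<dots> \<le> C * b" using x t C by simp
  finally show False using b \<delta> by simp
qed

text \<open>
  Binding constraints \<open>c j\<close> and hard constraints \<open>h l\<close> are treated as one family indexed by the disjoint sum
  \<open>B <+> A\<close>.  The dual vectors \<open>y k\<close> of its gradients turn stationarity at \<open>zs\<close> into the formula
  \<open>\<nu> s k = - (y k \<bullet> \<Phi> s zs)\<close> for the multipliers, which is linear in \<open>s = (1, w)\<close>; so they are
  bounded over \<open>K\<close>, and the gradient \<open>F\<close> of the Lagrangian is a linear family.
\<close>

lemma solution_path_estimate:
  fixes J :: "'z::euclidean_space \<Rightarrow> real" and V :: "'l::finite \<Rightarrow> 'z \<Rightarrow> real"
    and c h :: "nat \<Rightarrow> 'z \<Rightarrow> real" and K :: "(real ^ 'l) set"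
  assumes V_diff: "\<And>i' z. V i' differentiable (at z)"
    and K: "compact K" and fin: "finite B" "finite A"
    and U: "open U" "zs \<in> U"
    and c_C2: "\<And>j. j \<in> B \<Longrightarrow> C2_along (c j) U" and c0: "\<And>j. j \<in> B \<Longrightarrow> c j zs = 0"
    and h_C2: "\<And>l. l \<in> A \<Longrightarrow> C2_along (h l) U" and h0: "\<And>l. l \<in> A \<Longrightarrow> h l zs = 0"
    and licq: "joint_LICQ c B h A zs"
    and \<eta>0: "0 < \<eta>\<^sub>0"
    and path: "\<And>w. w \<in> K \<Longrightarrow> solution_path (Psi J V i w) c B h A zs (lam w) \<eta>\<^sub>0 (zp w) (lp w)"
    and smooth: "\<And>w. w \<in> K \<Longrightarrow>
      \<exists>U. open U \<and> zs \<in> U \<and> C2_along (Psi J V i w) (U \<inter> zp w ` {0..\<eta>\<^sub>0})"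
    and regular: "\<And>w. w \<in> K \<Longrightarrow> regular_limit Z (Psi J V i w) c B h A zs (lam w)"
  obtains C \<eta>\<^sub>1 \<Lambda> where "0 < C" "0 < \<eta>\<^sub>1" "\<eta>\<^sub>1 \<le> \<eta>\<^sub>0" "0 \<le> \<Lambda>"
    "\<And>w \<eta>. w \<in> K \<Longrightarrow> \<eta> \<in> {0..\<eta>\<^sub>1} \<Longrightarrow> norm (zp w \<eta> - zs) \<le> C * \<eta>"
    "\<And>w \<eta>. w \<in> K \<Longrightarrow> \<eta> \<in> {0..\<eta>\<^sub>1} \<Longrightarrow> (\<Sum>j\<in>B. \<bar>lp w \<eta> j - lam w j\<bar>) \<le> C * \<eta>"
    "\<And>w j. w \<in> K \<Longrightarrow> j \<in> B \<Longrightarrow> \<bar>lam w j\<bar> \<le> \<Lambda>"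
proof (cases "K = {}")
  case True
  show ?thesis by (rule that[of 1 \<eta>\<^sub>0 0]) (use True \<eta>0 in auto)
next
  case False
  then obtain w\<^sub>0 where w0: "w\<^sub>0 \<in> K" by blast
  define I where "I = B <+> A"
  define a where "a k = grad (case_sum c h k)" for k
  have finI: "finite I" using fin by (simp add: I_def)
  have zp0: "zp w 0 = zs" if "w \<in> K" for w using path[OF that] by (simp add: solution_path_def)
  have \<psi>_reg: "\<exists>U. open U \<and> zs \<in> U \<and> (\<forall>z\<in>U. Psi J V i w differentiable (at z))"
      "grad (Psi J V i w) differentiable (at zs)" if w: "w \<in> K" for w
  proof -
    from smooth[OF w] obtain U where U: "open U" "zs \<in> U"
      "C2_along (Psi J V i w) (U \<inter> zp w ` {0..\<eta>\<^sub>0})" by blast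
    moreover have "zs \<in> zp w ` {0..\<eta>\<^sub>0}" using zp0[OF w] \<eta>0 by force
    ultimately have *: "zs \<in> U \<inter> zp w ` {0..\<eta>\<^sub>0}" by blast
    from U(3) * show "\<exists>U. open U \<and> zs \<in> U \<and> (\<forall>z\<in>U. Psi J V i w differentiable (at z))"
      unfolding C2_along_def by (meson subsetD)
    from U(3) * show "grad (Psi J V i w) differentiable (at zs)"
      unfolding C2_along_def by blast
  qed
  obtain U\<^sub>0 where U0: "open U\<^sub>0" "zs \<in> U\<^sub>0" "\<And>z. z \<in> U\<^sub>0 \<Longrightarrow> Psi J V i w\<^sub>0 differentiable (at z)"
    using \<psi>_reg(1)[OF w0] by blast
  \<comment> \<open>\<open>J\<close> inherits differentiability near \<open>zs\<close> from one \<open>Psi\<close>; this gives one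
     neighbourhood in which every \<open>Psi\<close> has the gradient \<open>\<Phi>\<close>\<close>
  have J_diff: "J differentiable (at z)" if "z \<in> U\<^sub>0" for z
  proof -
    have "(\<lambda>z. Psi J V i w\<^sub>0 z - (\<Sum>i'\<in>UNIV - {i}. w\<^sub>0 $ i' * V i' z)) differentiable (at z)"
      using U0(3)[OF that] V_diff
      by (intro differentiable_diff differentiable_sum differentiable_mult) auto
    moreover have "(\<lambda>z. Psi J V i w\<^sub>0 z - (\<Sum>i'\<in>UNIV - {i}. w\<^sub>0 $ i' * V i' z)) = J"
      by (simp add: Psi_def)
    ultimately show ?thesis by (simp only:)
  qed
  define \<Phi> where "\<Phi> s z = fst s *\<^sub>R grad J z + (\<Sum>i'\<in>UNIV - {i}. (snd s $ i') *\<^sub>R grad (V i') z)"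
    for s :: "real \<times> (real ^ 'l)" and z
  have \<psi>_der: "(Psi J V i w has_derivative (\<lambda>v. \<Phi> (1, w) z \<bullet> v)) (at z)" if "z \<in> U\<^sub>0" for w z
    unfolding Psi_def[abs_def] \<Phi>_def
    by (rule derivative_eq_intros has_derivative_sum grad_has_derivative J_diff V_diff that refl)+
      (auto simp: inner_add_left inner_sum_left)
  have grad\<psi>: "grad (Psi J V i w) z = \<Phi> (1, w) z" if "z \<in> U\<^sub>0" for w z
    by (rule gradI[OF \<psi>_der[OF that]])
  have cc_der: "(case_sum c h k has_derivative (\<lambda>v. a k z \<bullet> v)) (at z)" if "k \<in> I" "z \<in> U" for k z
    unfolding a_def using that c_C2 h_C2
    by (intro grad_has_derivative) (auto simp: I_def split: sum.splits intro: C2_alongD(1))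
  have a_diff: "a k differentiable (at zs)" if "k \<in> I" for k
    unfolding a_def using that c_C2 h_C2 U(2)
    by (auto simp: I_def split: sum.splits intro: C2_alongD(2))
  have stat: "stationary \<psi> c B h A l \<mu> z \<longleftrightarrow> grad \<psi> z + (\<Sum>k\<in>I. case_sum l \<mu> k *\<^sub>R a k z) = 0"
    for \<psi> l \<mu> z
    unfolding I_def a_def by (rule stationary_Plus[OF fin])
  have a_sum: "case_sum (\<lambda>j. grad (c j) zs) (\<lambda>l. grad (h l) zs) = (\<lambda>k. a k zs)"
    by (auto simp: a_def split: sum.splits)
  obtain y where dual: "\<forall>k\<in>I. \<forall>l\<in>I. y k \<bullet> a l zs = (if k = l then 1 else 0)"
    using licq biorthogonal_family[of "\<lambda>k. a k zs" I] unfolding joint_LICQ_def a_sum I_def by blast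
  define \<nu> where "\<nu> s k = - (y k \<bullet> \<Phi> s zs)" for s k
  define F where "F s z = \<Phi> s z + (\<Sum>k\<in>I. \<nu> s k *\<^sub>R a k z)" for s z
  have lin\<Phi>: "linear (\<lambda>s. \<Phi> s z)" for z
    by (rule linearI) (simp_all add: \<Phi>_def algebra_simps sum.distrib scaleR_sum_right)
  have lin\<nu>: "linear (\<lambda>s. \<nu> s k)" for k
    by (rule linearI) (simp_all add: \<nu>_def linear_add[OF lin\<Phi>] linear_cmul[OF lin\<Phi>] inner_add_right)
  have linF: "linear (\<lambda>s. F s z)" for z
    by (rule linearI) (simp_all add: F_def linear_add[OF lin\<Phi>] linear_cmul[OF lin\<Phi>]
      linear_add[OF lin\<nu>] linear_cmul[OF lin\<nu>] algebra_simps sum.distrib scaleR_sum_right)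
  have \<nu>_eq: "\<nu> (1, w) k = case_sum (lam w) \<mu> k"
    if st: "stationary (Psi J V i w) c B h A (lam w) \<mu> zs" and k: "k \<in> I" for w \<mu> k
  proof -
    have "\<Phi> (1, w) zs = - (\<Sum>l\<in>I. case_sum (lam w) \<mu> l *\<^sub>R a l zs)"
      using st by (simp add: stat grad\<psi>[OF U0(2)] eq_neg_iff_add_eq_0)
    then have "\<nu> (1, w) k = (\<Sum>l\<in>I. case_sum (lam w) \<mu> l * (y k \<bullet> a l zs))"
      by (simp add: \<nu>_def inner_sum_right)
    also have "\<dots> = (\<Sum>l\<in>I. if l = k then case_sum (lam w) \<mu> l else 0)"
      by (rule sum.cong) (use dual k in auto)
    finally show ?thesis using finI k by simp
  qed
  have ex_\<mu>: "\<exists>\<mu>. stationary (Psi J V i w) c B h A (lam w) \<mu> zs \<and>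
       (\<forall>v. v \<noteq> 0 \<and> (\<forall>j\<in>B. grad (c j) zs \<bullet> v = 0) \<and> (\<forall>l\<in>A. grad (h l) zs \<bullet> v = 0) \<longrightarrow>
           0 < hess (lagrangian (Psi J V i w) c B h A (lam w) \<mu>) zs v \<bullet> v)" if "w \<in> K" for w
    using regular[OF that] unfolding regular_limit_def by blast
  have F0: "F (1, w) zs = 0" if w: "w \<in> K" for w
  proof -
    from ex_\<mu>[OF w] obtain \<mu> where st: "stationary (Psi J V i w) c B h A (lam w) \<mu> zs" by blast
    have "F (1, w) zs = \<Phi> (1, w) zs + (\<Sum>k\<in>I. case_sum (lam w) \<mu> k *\<^sub>R a k zs)"
      by (simp add: F_def \<nu>_eq[OF st])
    then show ?thesis using st by (simp add: stat grad\<psi>[OF U0(2)])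
  qed
  have F_diff: "F (1, w) differentiable (at zs)" if w: "w \<in> K" for w
  proof -
    obtain D where "(grad (Psi J V i w) has_derivative D) (at zs)"
      using \<psi>_reg(2)[OF w] by (auto simp: differentiable_def)
    then have "(\<Phi> (1, w) has_derivative D) (at zs)"
      by (rule has_derivative_transform_within_open[OF _ U0(1,2)]) (simp add: grad\<psi>)
    then have "\<Phi> (1, w) differentiable (at zs)" by (auto simp: differentiable_def)
    then show ?thesis unfolding F_def[abs_def]
      using finI a_diff
      by (intro differentiable_add differentiable_sum) (auto intro: differentiable_scaleR)
  qed
  define T where "T = {v. \<forall>k\<in>I. a k zs \<bullet> v = 0}"
  have T: "subspace T" by (auto simp: T_def subspace_def inner_add_right)
  have F_pos: "0 < frechet_derivative (F (1, w)) (at zs) u \<bullet> u"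
    if w: "w \<in> K" and u: "u \<in> T" "u \<noteq> 0" for w u
  proof -
    from ex_\<mu>[OF w] obtain \<mu> where st: "stationary (Psi J V i w) c B h A (lam w) \<mu> zs"
      and pos: "\<And>v. v \<noteq> 0 \<Longrightarrow> \<forall>j\<in>B. grad (c j) zs \<bullet> v = 0 \<Longrightarrow> \<forall>l\<in>A. grad (h l) zs \<bullet> v = 0 \<Longrightarrow>
           0 < hess (lagrangian (Psi J V i w) c B h A (lam w) \<mu>) zs v \<bullet> v" by blast
    let ?L = "lagrangian (Psi J V i w) c B h A (lam w) \<mu>"
    have "(?L has_derivative (\<lambda>v. F (1, w) z \<bullet> v)) (at z)" if "z \<in> U\<^sub>0 \<inter> U" for z
    proof -
      have "?L = (\<lambda>z. Psi J V i w z + (\<Sum>k\<in>I. \<nu> (1, w) k * case_sum c h k z))"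
        by (simp add: lagrangian_Plus[OF fin] I_def[symmetric] \<nu>_eq[OF st])
      moreover have "((\<lambda>z. Psi J V i w z + (\<Sum>k\<in>I. \<nu> (1, w) k * case_sum c h k z)) has_derivative
          (\<lambda>v. \<Phi> (1, w) z \<bullet> v + (\<Sum>k\<in>I. \<nu> (1, w) k * (a k z \<bullet> v)))) (at z)"
        using that by (intro has_derivative_add has_derivative_sum has_derivative_mult_right
            \<psi>_der cc_der) auto
      ultimately show ?thesis by (simp add: F_def inner_add_left inner_sum_left)
    qed
    then have gL: "grad ?L z = F (1, w) z" if "z \<in> U\<^sub>0 \<inter> U" for z using that gradI by blast
    have "(F (1, w) has_derivative frechet_derivative (F (1, w)) (at zs)) (at zs)"
      using F_diff[OF w] frechet_derivative_works by blast
    then have "(grad ?L has_derivative frechet_derivative (F (1, w)) (at zs)) (at zs)"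
      by (rule has_derivative_transform_within_open[of _ _ _ _ "U\<^sub>0 \<inter> U"]) (use U0 U gL in auto)
    then have "hess ?L zs = frechet_derivative (F (1, w)) (at zs)"
      unfolding hess_def by (rule frechet_derivative_at[symmetric])
    moreover have "0 < hess ?L zs u \<bullet> u"
      by (rule pos[OF u(2)]) (use u(1) in \<open>force simp: T_def I_def a_def\<close>)+
    ultimately show ?thesis by simp
  qed
  have K': "compact (Pair 1 ` K :: (real \<times> (real ^ 'l)) set)"
    by (intro compact_continuous_image K continuous_intros)
  obtain \<alpha> M where \<alpha>M: "0 < \<alpha>" "0 \<le> M"
    "\<forall>s\<in>Pair 1 ` K. \<forall>u\<in>T. \<alpha> * (norm u)\<^sup>2 \<le> frechet_derivative (F s) (at zs) u \<bullet> u"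
    "\<forall>s\<in>Pair 1 ` K. \<forall>x. norm (frechet_derivative (F s) (at zs) x) \<le> M * norm x"
    "\<forall>e>0. \<forall>\<^sub>F z in nhds zs. \<forall>s\<in>Pair 1 ` K.
       norm (F s z - F s zs - frechet_derivative (F s) (at zs) (z - zs)) \<le> e * norm (z - zs)"
  proof (rule linear_family_uniformly_regular[OF linF K' _ T, where zs = zs])
    show "F s differentiable (at zs)" if "s \<in> Pair 1 ` K" for s using that F_diff by auto
    show "0 < frechet_derivative (F s) (at zs) u \<bullet> u"
      if "s \<in> Pair 1 ` K" "u \<in> T" "u \<noteq> 0" for s u using that F_pos by auto
  qed
  obtain \<Lambda> where \<Lambda>: "0 < \<Lambda>" "\<And>w k. w \<in> K \<Longrightarrow> k \<in> I \<Longrightarrow> \<bar>\<nu> (1, w) k\<bar> \<le> \<Lambda>"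
  proof -
    have "continuous_on (Pair 1 ` K) (\<lambda>s. \<Sum>k\<in>I. \<bar>\<nu> s k\<bar>)"
      by (intro continuous_intros linear_continuous_on_compose[OF _ lin\<nu>])
    then have "bounded ((\<lambda>s. \<Sum>k\<in>I. \<bar>\<nu> s k\<bar>) ` Pair 1 ` K)"
      by (rule compact_imp_bounded[OF compact_continuous_image[OF _ K']])
    then obtain \<Lambda> where \<Lambda>: "0 < \<Lambda>" "\<And>w. w \<in> K \<Longrightarrow> norm (\<Sum>k\<in>I. \<bar>\<nu> (1, w) k\<bar>) \<le> \<Lambda>"
      unfolding bounded_pos by auto
    show thesis
    proof (rule that[OF \<Lambda>(1)])
      fix w k assume "w \<in> K" "k \<in> I"
      moreover have "\<bar>\<nu> (1, w) k\<bar> \<le> (\<Sum>k\<in>I. \<bar>\<nu> (1, w) k\<bar>)"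
        by (rule member_le_sum) (use \<open>k \<in> I\<close> finI in auto)
      ultimately show "\<bar>\<nu> (1, w) k\<bar> \<le> \<Lambda>" using \<Lambda>(2)[of w] by simp
    qed
  qed
  have \<nu>_lam: "\<nu> (1, w) (Inl j) = lam w j" if "w \<in> K" "j \<in> B" for w j
  proof -
    from ex_\<mu>[OF that(1)] obtain \<mu> where
      st: "stationary (Psi J V i w) c B h A (lam w) \<mu> zs" by blast
    have "Inl j \<in> I" using that(2) by (auto simp: I_def)
    then show ?thesis using \<nu>_eq[OF st, of "Inl j"] by simp
  qed
  \<comment> \<open>on the path the hard constraints are 0 and the binding ones are \<open>\<eta> / 2 * (\<nu> + d)\<close>, where
     \<open>\<bar>\<nu>\<bar> \<le> \<Lambda>\<close>; this explains the bound on the constraint values\<close>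
  obtain C \<eta>' where C: "0 < C" "0 < \<eta>'" and ev:
    "\<forall>\<^sub>F z in nhds zs. \<forall>s\<in>Pair 1 ` K. \<forall>d. \<forall>\<eta>\<in>{0..\<eta>'}.
       F s z + (\<Sum>k\<in>I. d k *\<^sub>R a k z) = 0 \<longrightarrow>
       (\<forall>k\<in>I. \<bar>case_sum c h k z\<bar> \<le> \<eta> * (\<Lambda> + \<bar>d k\<bar>)) \<longrightarrow>
       norm (z - zs) + (\<Sum>k\<in>I. \<bar>d k\<bar>) \<le> C * \<eta>"
  proof (rule stationary_perturbation[where I = I and a = a and c = "case_sum c h" and F = F
        and D = "\<lambda>s. frechet_derivative (F s) (at zs)" and K = "Pair 1 ` K" and \<Lambda> = \<Lambda>])
    show "finite I" by fact
    show "\<forall>k\<in>I. \<forall>l\<in>I. y k \<bullet> a l zs = (if k = l then 1 else 0)" by fact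
    show "0 < \<alpha>" "0 \<le> M" by fact+
    show "0 \<le> \<Lambda>" using \<Lambda> by simp
    show "linear (frechet_derivative (F s) (at zs))" if "s \<in> Pair 1 ` K" for s
      using that F_diff by (auto intro: linear_frechet_derivative)
    show "norm (frechet_derivative (F s) (at zs) x) \<le> M * norm x" if "s \<in> Pair 1 ` K" for s x
      using \<alpha>M(4) that by blast
    show "\<alpha> * (norm u)\<^sup>2 \<le> frechet_derivative (F s) (at zs) u \<bullet> u"
      if "s \<in> Pair 1 ` K" "\<forall>k\<in>I. a k zs \<bullet> u = 0" for s u
      using \<alpha>M(3) that by (auto simp: T_def)
    show "\<forall>\<^sub>F z in nhds zs. \<forall>s\<in>Pair 1 ` K.
        norm (F s z - frechet_derivative (F s) (at zs) (z - zs)) \<le> e * norm (z - zs)" if "0 < e" for e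
      using \<alpha>M(5) that by (simp add: F0)
    show "(case_sum c h k has_derivative (\<bullet>) (a k zs)) (at zs)" if "k \<in> I" for k
      by (rule cc_der[OF that U(2)])
    show "case_sum c h k zs = 0" if "k \<in> I" for k
      using that c0 h0 by (auto simp: I_def)
    show "isCont (a k) zs" if "k \<in> I" for k
      by (rule differentiable_imp_continuous_within[OF a_diff[OF that]])
  qed blast
  have "\<forall>\<^sub>F z in nhds zs. z \<in> U\<^sub>0" using U0(1,2) by (rule eventually_nhds_in_open)
  from eventually_conj[OF this ev] obtain r where r: "0 < r" and
    near: "\<And>z. dist z zs < r \<Longrightarrow> z \<in> U\<^sub>0"
      "\<And>z w d \<eta>. dist z zs < r \<Longrightarrow> w \<in> K \<Longrightarrow> \<eta> \<in> {0..\<eta>'} \<Longrightarrow>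
        F (1, w) z + (\<Sum>k\<in>I. d k *\<^sub>R a k z) = 0 \<Longrightarrow>
        \<forall>k\<in>I. \<bar>case_sum c h k z\<bar> \<le> \<eta> * (\<Lambda> + \<bar>d k\<bar>) \<Longrightarrow>
        norm (z - zs) + (\<Sum>k\<in>I. \<bar>d k\<bar>) \<le> C * \<eta>"
    unfolding eventually_nhds_metric by auto
  define \<eta>\<^sub>1 where "\<eta>\<^sub>1 = min \<eta>\<^sub>0 (min \<eta>' (r / (4 * C)))"
  have \<eta>1: "0 < \<eta>\<^sub>1" "\<eta>\<^sub>1 \<le> \<eta>\<^sub>0" "\<eta>\<^sub>1 \<le> \<eta>'" "2 * (C * \<eta>\<^sub>1) \<le> r / 2"
  proof -
    show "0 < \<eta>\<^sub>1" "\<eta>\<^sub>1 \<le> \<eta>\<^sub>0" "\<eta>\<^sub>1 \<le> \<eta>'" using \<eta>0 C r by (auto simp: \<eta>\<^sub>1_def)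
    have "\<eta>\<^sub>1 \<le> r / (4 * C)" by (simp add: \<eta>\<^sub>1_def)
    then show "2 * (C * \<eta>\<^sub>1) \<le> r / 2" using C by (simp add: field_simps)
  qed
  have local: "norm (zp w \<eta> - zs) + (\<Sum>j\<in>B. \<bar>lp w \<eta> j - lam w j\<bar>) \<le> C * \<eta>"
    if w: "w \<in> K" and \<eta>: "\<eta> \<in> {0..\<eta>\<^sub>1}" and z: "norm (zp w \<eta> - zs) \<le> r / 2" for w \<eta>
  proof -
    have "\<eta> \<in> {0..\<eta>\<^sub>0}" using \<eta> \<eta>1 by auto
    with path[OF w] obtain \<mu> where
      st: "stationary (Psi J V i w) c B h A (lp w \<eta>) \<mu> (zp w \<eta>)"
      and hz: "\<forall>l\<in>A. h l (zp w \<eta>) = 0" and cz: "\<forall>j\<in>B. c j (zp w \<eta>) = \<eta> / 2 * lp w \<eta> j"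
      unfolding solution_path_def by blast
    define d where "d k = case_sum (lp w \<eta>) \<mu> k - \<nu> (1, w) k" for k
    have close: "dist (zp w \<eta>) zs < r" using z r by (simp add: dist_norm)
    have "F (1, w) (zp w \<eta>) + (\<Sum>k\<in>I. d k *\<^sub>R a k (zp w \<eta>)) = 0"
      using st near(1)[OF close]
      by (simp add: stat grad\<psi> F_def d_def algebra_simps sum_subtractf)
    moreover have "\<forall>k\<in>I. \<bar>case_sum c h k (zp w \<eta>)\<bar> \<le> \<eta> * (\<Lambda> + \<bar>d k\<bar>)"
    proof
      fix k assume k: "k \<in> I"
      show "\<bar>case_sum c h k (zp w \<eta>)\<bar> \<le> \<eta> * (\<Lambda> + \<bar>d k\<bar>)"
      proof (cases k)
        case (Inl j)
        then have j: "j \<in> B" using k by (auto simp: I_def)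
        have "\<bar>lp w \<eta> j\<bar> \<le> \<Lambda> + \<bar>d k\<bar>" using \<Lambda>(2)[OF w k] by (simp add: d_def Inl)
        then have "\<eta> / 2 * \<bar>lp w \<eta> j\<bar> \<le> \<eta> * (\<Lambda> + \<bar>d k\<bar>)" using \<eta> \<Lambda>(1) by (intro mult_mono) auto
        moreover have "\<bar>c j (zp w \<eta>)\<bar> = \<eta> / 2 * \<bar>lp w \<eta> j\<bar>"
          using cz[rule_format, OF j] \<eta> by (simp only: abs_mult) simp
        ultimately show ?thesis by (simp add: Inl)
      next
        case (Inr l)
        then show ?thesis using k hz \<eta> \<Lambda>(1) by (auto simp: I_def)
      qed
    qed
    moreover have "\<eta> \<in> {0..\<eta>'}" using \<eta> \<eta>1 by auto
    ultimately have "norm (zp w \<eta> - zs) + (\<Sum>k\<in>I. \<bar>d k\<bar>) \<le> C * \<eta>"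
      using near(2)[OF close w] by blast
    moreover have "(\<Sum>k\<in>I. \<bar>d k\<bar>) = (\<Sum>j\<in>B. \<bar>lp w \<eta> j - lam w j\<bar>) + (\<Sum>l\<in>A. \<bar>d (Inr l)\<bar>)"
      using fin w by (simp add: I_def sum.Plus d_def \<nu>_lam)
    moreover have "0 \<le> (\<Sum>l\<in>A. \<bar>d (Inr l)\<bar>)" by (simp add: sum_nonneg)
    ultimately show ?thesis by linarith
  qed
  have path_close: "norm (zp w \<eta> - zs) \<le> C * \<eta>" if w: "w \<in> K" and \<eta>: "\<eta> \<in> {0..\<eta>\<^sub>1}" for w \<eta>
  proof (rule continuous_confinement[where b = \<eta>\<^sub>1 and \<delta> = "r / 2"])
    show "zp w 0 = zs" "0 < C" "2 * (C * \<eta>\<^sub>1) \<le> r / 2" "\<eta> \<in> {0..\<eta>\<^sub>1}" by (fact zp0[OF w] C(1) \<eta>1(4) \<eta>)+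
    show "continuous_on {0..\<eta>\<^sub>1} (zp w)"
      using path[OF w] \<eta>1(2) unfolding solution_path_def
      by (auto intro: continuous_on_subset)
    show "0 < r / 2" using r by simp
    show "norm (zp w t - zs) \<le> C * t" if "t \<in> {0..\<eta>\<^sub>1}" "norm (zp w t - zs) \<le> r / 2" for t
    proof -
      have "0 \<le> (\<Sum>j\<in>B. \<bar>lp w t j - lam w j\<bar>)" by (simp add: sum_nonneg)
      then show ?thesis using local[OF w that] by linarith
    qed
  qed
  show ?thesis
  proof (rule that[of C \<eta>\<^sub>1 \<Lambda>])
    show "0 < C" "0 < \<eta>\<^sub>1" "\<eta>\<^sub>1 \<le> \<eta>\<^sub>0" by fact+
    show "0 \<le> \<Lambda>" using \<Lambda> by simp
    show "\<bar>lam w j\<bar> \<le> \<Lambda>" if "w \<in> K" "j \<in> B" for w j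
      using \<Lambda>(2)[of w "Inl j"] \<nu>_lam that by (auto simp: I_def)
    fix w \<eta> assume w: "w \<in> K" and \<eta>: "\<eta> \<in> {0..\<eta>\<^sub>1}"
    show *: "norm (zp w \<eta> - zs) \<le> C * \<eta>" by (rule path_close[OF w \<eta>])
    have "C * \<eta> \<le> C * \<eta>\<^sub>1" using \<eta> C(1) by simp
    moreover have "0 \<le> C * \<eta>\<^sub>1" using \<eta>1(1) C(1) by simp
    ultimately have "norm (zp w \<eta> - zs) \<le> r / 2" using * \<eta>1(4) by linarith
    from local[OF w \<eta> this] norm_ge_zero[of "zp w \<eta> - zs"]
    show "(\<Sum>j\<in>B. \<bar>lp w \<eta> j - lam w j\<bar>) \<le> C * \<eta>" by linarith
  qed
qed

section \<open>Norms and thresholds\<close>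

lemma max_norm_le_iff:
  "finite B \<Longrightarrow> max_norm v B \<le> r \<longleftrightarrow> 0 \<le> r \<and> (\<forall>j\<in>B. \<bar>v j\<bar> \<le> r)"
  by (simp add: max_norm_def)

lemma L2_set_power2: "(L2_set v B)\<^sup>2 = (\<Sum>j\<in>B. (v j)\<^sup>2)"
  by (simp add: L2_set_def sum_nonneg)

text \<open>
  The second and third entry of the threshold limit the leading term and the remainder to \<open>e / 2\<close> each.
\<close>

lemma raw_threshold_sufficient:
  assumes e: "0 < e" and wbar: "0 < wbar"
    and thr: "raw_threshold wbar C lam B e \<le> wi"
  shows "wbar \<le> wi" and "max_norm lam B / (2 * wi) + C / wi ^ 2 \<le> e"
proof -
  from thr have *: "wbar \<le> wi" "max_norm lam B / e \<le> wi" "sqrt (2 * C / e) \<le> wi"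
    by (simp_all add: raw_threshold_def)
  show "wbar \<le> wi" by fact
  have wi: "0 < wi" using * wbar by simp
  have "max_norm lam B / (2 * wi) \<le> e / 2" using *(2) e wi by (simp add: field_simps)
  moreover have "2 * C / e \<le> wi ^ 2"
    using *(3) by (rule sqrt_le_D)
  then have "C / wi ^ 2 \<le> e / 2" using e wi by (simp add: field_simps)
  ultimately show "max_norm lam B / (2 * wi) + C / wi ^ 2 \<le> e" by linarith
qed

lemma violation_threshold_sufficient:
  assumes e: "0 < e" and wbar: "0 < wbar" and C: "0 \<le> C"
    and thr: "violation_threshold wbar C lam B e \<le> wi"
  shows "wbar \<le> wi" and "(L2_set lam B)\<^sup>2 / (4 * wi ^ 2) + C / wi ^ 3 \<le> e"
proof -
  from thr have *: "wbar \<le> wi" "L2_set lam B / sqrt (2 * e) \<le> wi" "root 3 (2 * C / e) \<le> wi"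
    by (simp_all add: violation_threshold_def)
  show "wbar \<le> wi" by fact
  have wi: "0 < wi" using * wbar by simp
  have "L2_set lam B \<le> wi * sqrt (2 * e)" using *(2) e by (simp add: field_simps)
  then have "(L2_set lam B)\<^sup>2 \<le> (wi * sqrt (2 * e))\<^sup>2"
    by (rule power_mono) (rule L2_set_nonneg)
  also have "\<dots> = wi ^ 2 * (2 * e)" using e by (simp add: power_mult_distrib)
  finally have L2: "(L2_set lam B)\<^sup>2 / (4 * wi ^ 2) \<le> e / 2" using wi by (simp add: field_simps)
  have "root 3 (2 * C / e) ^ 3 \<le> wi ^ 3"
    using *(3) e C by (intro power_mono) auto
  moreover have "root 3 (2 * C / e) ^ 3 = 2 * C / e" using e C by (intro real_root_pow_pos2) auto
  ultimately have "2 * C / e \<le> wi ^ 3" by (simp only:)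
  then have "C / wi ^ 3 \<le> e / 2" using e wi by (simp add: field_simps)
  with L2 show "(L2_set lam B)\<^sup>2 / (4 * wi ^ 2) + C / wi ^ 3 \<le> e" by linarith
qed

text \<open>
  As \<open>e\<close> tends to 0, the entry \<open>max_norm lam B / e\<close>, positive by strict complementarity, dominates: the
  other two entries are \<open>O(1)\<close> and \<open>O(e powr (- 1 / 2))\<close>.
\<close>

lemma raw_threshold_bigtheta:
  assumes B: "finite B" "B \<noteq> {}" and lam: "\<forall>j\<in>B. 0 < lam j" and wbar: "0 < wbar" and C: "0 \<le> C"
  shows "(\<lambda>e. raw_threshold wbar C lam B e) \<in> \<Theta>[at_right 0](\<lambda>e. 1 / e)"
proof
  let ?c = "max_norm lam B"
  have c: "0 < ?c"
  proof -
    obtain j where "j \<in> B" using B by blast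
    then show ?thesis using max_norm_le_iff[OF B(1), of lam ?c] lam by force
  qed
  have small: "\<forall>\<^sub>F e in at_right (0::real). 0 < e \<and> e < 1"
    by (rule eventually_at_rightI[of 0 1]) auto
  have up: "raw_threshold wbar C lam B e \<le> (wbar + ?c + sqrt (2 * C)) * (1 / e)"
    if e: "0 < e" "e < 1" for e
  proof -
    have "wbar \<le> wbar / e" using e wbar by (simp add: field_simps)
    moreover have "e \<le> sqrt e" using e by (intro real_le_rsqrt) (simp add: power2_eq_square)
    then have "sqrt (2 * C) / sqrt e \<le> sqrt (2 * C) / e" using e C by (intro divide_left_mono) auto
    then have "sqrt (2 * C / e) \<le> sqrt (2 * C) / e" by (simp add: real_sqrt_divide)
    moreover have "0 \<le> wbar / e" "0 \<le> ?c / e" "0 \<le> sqrt (2 * C) / e" using e wbar c C by auto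
    ultimately show ?thesis
      by (simp add: raw_threshold_def add_divide_distrib)
  qed
  have low: "?c * (1 / e) \<le> raw_threshold wbar C lam B e" for e
    by (simp add: raw_threshold_def)
  show "(\<lambda>e. raw_threshold wbar C lam B e) \<in> O[at_right 0](\<lambda>e. 1 / e)"
  proof (rule bigoI)
    from small show "\<forall>\<^sub>F e in at_right 0. norm (raw_threshold wbar C lam B e)
        \<le> (wbar + ?c + sqrt (2 * C)) * norm (1 / e)"
    proof eventually_elim
      case (elim e)
      moreover have "0 \<le> ?c * (1 / e)" using c elim by simp
      ultimately show ?case using up[of e] low[of e] by simp
    qed
  qed
  show "(\<lambda>e. raw_threshold wbar C lam B e) \<in> \<Omega>[at_right 0](\<lambda>e. 1 / e)"
  proof (rule landau_omega.bigI[OF c])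
    from small show "\<forall>\<^sub>F e in at_right 0. norm (raw_threshold wbar C lam B e) \<ge> ?c * norm (1 / e)"
    proof eventually_elim
      case (elim e)
      moreover have "0 \<le> ?c * (1 / e)" using c elim by simp
      ultimately show ?case using low[of e] by simp
    qed
  qed
qed

text \<open>
  Here the dominating entry is \<open>L2_set lam B / sqrt (2 * e)\<close>; the remainder contributes only
  \<open>O(e powr (- 1 / 3))\<close>.
\<close>

lemma violation_threshold_bigtheta:
  assumes B: "finite B" "B \<noteq> {}" and lam: "\<forall>j\<in>B. 0 < lam j" and wbar: "0 < wbar" and C: "0 \<le> C"
  shows "(\<lambda>e. violation_threshold wbar C lam B e) \<in> \<Theta>[at_right 0](\<lambda>e. e powr (- (1 / 2)))"
proof
  let ?c = "L2_set lam B / sqrt 2"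
  have c: "0 < ?c"
  proof -
    have "0 < (\<Sum>j\<in>B. (lam j)\<^sup>2)" using B lam by (intro sum_pos) auto
    then show ?thesis by (simp add: L2_set_def)
  qed
  have small: "\<forall>\<^sub>F e in at_right (0::real). 0 < e \<and> e < 1"
    by (rule eventually_at_rightI[of 0 1]) auto
  have pw: "e powr (- (1 / 2)) = 1 / sqrt e" if "0 < e" for e :: real
    using that by (simp only: powr_minus powr_half_sqrt less_imp_le inverse_eq_divide)
  have up: "violation_threshold wbar C lam B e \<le> (wbar + ?c + root 3 (2 * C)) * (1 / sqrt e)"
    if e: "0 < e" "e < 1" for e
  proof -
    have "wbar \<le> wbar / sqrt e" using e wbar by (simp add: field_simps)
    moreover have "sqrt e \<le> root 3 e"
      using e real_root_increasing[of 2 3 e] by (simp add: sqrt_def)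
    then have "root 3 (2 * C) / root 3 e \<le> root 3 (2 * C) / sqrt e"
      using e C by (intro divide_left_mono) auto
    then have "root 3 (2 * C / e) \<le> root 3 (2 * C) / sqrt e" by (simp add: real_root_divide)
    moreover have "0 \<le> wbar / sqrt e" "0 \<le> ?c / sqrt e" "0 \<le> root 3 (2 * C) / sqrt e"
      using e wbar c C by auto
    moreover have "L2_set lam B / sqrt (2 * e) = ?c / sqrt e" by (simp add: real_sqrt_mult)
    moreover have "(wbar + ?c + root 3 (2 * C)) * (1 / sqrt e)
        = wbar / sqrt e + ?c / sqrt e + root 3 (2 * C) / sqrt e"
      by (simp add: add_divide_distrib)
    ultimately have "wbar \<le> (wbar + ?c + root 3 (2 * C)) * (1 / sqrt e)"
        "L2_set lam B / sqrt (2 * e) \<le> (wbar + ?c + root 3 (2 * C)) * (1 / sqrt e)"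
        "root 3 (2 * C / e) \<le> (wbar + ?c + root 3 (2 * C)) * (1 / sqrt e)"
      by linarith+
    then show ?thesis unfolding violation_threshold_def by (subst Max_le_iff) auto
  qed
  have low: "?c * (1 / sqrt e) \<le> violation_threshold wbar C lam B e" for e
    by (simp add: violation_threshold_def real_sqrt_mult)
  show "(\<lambda>e. violation_threshold wbar C lam B e) \<in> O[at_right 0](\<lambda>e. e powr (- (1 / 2)))"
  proof (rule bigoI)
    from small show "\<forall>\<^sub>F e in at_right 0. norm (violation_threshold wbar C lam B e)
        \<le> (wbar + ?c + root 3 (2 * C)) * norm (e powr (- (1 / 2)))"
    proof eventually_elim
      case (elim e)
      then have p: "norm (e powr (- (1 / 2))) = 1 / sqrt e" by (simp add: pw)
      have "0 \<le> ?c * (1 / sqrt e)" using c elim by simp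
      then have "0 \<le> violation_threshold wbar C lam B e" using low[of e] by linarith
      then have v: "norm (violation_threshold wbar C lam B e) = violation_threshold wbar C lam B e"
        by (simp only: real_norm_def abs_of_nonneg)
      show ?case unfolding p v using up elim by blast
    qed
  qed
  show "(\<lambda>e. violation_threshold wbar C lam B e) \<in> \<Omega>[at_right 0](\<lambda>e. e powr (- (1 / 2)))"
  proof (rule landau_omega.bigI[OF c])
    from small show "\<forall>\<^sub>F e in at_right 0.
        norm (violation_threshold wbar C lam B e) \<ge> ?c * norm (e powr (- (1 / 2)))"
    proof eventually_elim
      case (elim e)
      moreover have "norm (e powr (- (1 / 2))) = 1 / sqrt e" using elim by (simp add: pw)
      ultimately show ?case using low[of e] by (simp only: real_norm_def)
    qed
  qed
qed

section \<open>Compliance of the local branch\<close>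

lemma C2_along_subset:
  assumes "C2_along \<phi> S" and "T \<subseteq> S"
  shows "C2_along \<phi> T"
  using assms unfolding C2_along_def by (meson continuous_on_subset subset_trans subsetD)

lemma sum_squares_perturbation:
  assumes B: "finite B" and \<Lambda>: "0 \<le> \<Lambda>" "\<And>j. j \<in> B \<Longrightarrow> \<bar>lam j\<bar> \<le> \<Lambda>"
    and s: "(\<Sum>j\<in>B. \<bar>l j - lam j\<bar>) \<le> s"
  shows "(\<Sum>j\<in>B. (l j)\<^sup>2) \<le> (L2_set lam B)\<^sup>2 + 2 * \<Lambda> * s + s\<^sup>2"
proof -
  have s0: "0 \<le> s" using s by (rule order_trans[rotated]) (simp add: sum_nonneg)
  have "(\<Sum>j\<in>B. (l j)\<^sup>2) \<le> (\<Sum>j\<in>B. (lam j)\<^sup>2 + (2 * \<Lambda> + s) * \<bar>l j - lam j\<bar>)"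
  proof (rule sum_mono)
    fix j assume j: "j \<in> B"
    define d where "d = l j - lam j"
    have "\<bar>d\<bar> \<le> (\<Sum>j\<in>B. \<bar>l j - lam j\<bar>)"
      unfolding d_def by (rule member_le_sum[OF j]) (use B in auto)
    then have "\<bar>d\<bar> * \<bar>d\<bar> \<le> s * \<bar>d\<bar>" using s by (intro mult_right_mono) auto
    moreover have "lam j * d \<le> \<Lambda> * \<bar>d\<bar>"
      using mult_right_mono[OF \<Lambda>(2)[OF j], of "\<bar>d\<bar>"] abs_ge_self[of "lam j * d"]
      by (simp add: abs_mult)
    moreover have "(l j)\<^sup>2 = (lam j)\<^sup>2 + 2 * (lam j * d) + \<bar>d\<bar> * \<bar>d\<bar>"
      by (simp add: d_def power2_eq_square algebra_simps)
    ultimately have "(l j)\<^sup>2 \<le> (lam j)\<^sup>2 + 2 * (\<Lambda> * \<bar>d\<bar>) + s * \<bar>d\<bar>" by linarith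
    then show "(l j)\<^sup>2 \<le> (lam j)\<^sup>2 + (2 * \<Lambda> + s) * \<bar>l j - lam j\<bar>"
      unfolding d_def by (simp add: algebra_simps)
  qed
  also have "\<dots> = (L2_set lam B)\<^sup>2 + (2 * \<Lambda> + s) * (\<Sum>j\<in>B. \<bar>l j - lam j\<bar>)"
    by (simp add: sum.distrib L2_set_power2 sum_distrib_left)
  also have "(2 * \<Lambda> + s) * (\<Sum>j\<in>B. \<bar>l j - lam j\<bar>) \<le> (2 * \<Lambda> + s) * s"
    using s s0 \<Lambda>(1) by (intro mult_left_mono) auto
  finally show ?thesis by (simp add: power2_eq_square algebra_simps)
qed

lemma violation_eq_0_iff: "violation g m i z = 0 \<longleftrightarrow> (\<forall>j\<in>{1..m i}. g i j z \<le> 0)"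
  by (auto simp: violation_def sum_nonneg_eq_0_iff max_def not_le less_imp_le)

lemma violation_le_binding:
  assumes "\<And>j. j \<in> {1..m i} - binding g m i zs \<Longrightarrow> g i j z \<le> 0"
  shows "violation g m i z \<le> (\<Sum>j\<in>binding g m i zs. (g i j z)\<^sup>2)"
proof -
  have "violation g m i z = (\<Sum>j\<in>binding g m i zs. (max 0 (g i j z))\<^sup>2)"
    unfolding violation_def
  proof (rule sum.mono_neutral_right)
    show "\<forall>j\<in>{1..m i} - binding g m i zs. (max 0 (g i j z))\<^sup>2 = 0"
      using assms by (simp add: max_absorb1)
  qed (auto simp: binding_def)
  also have "\<dots> \<le> (\<Sum>j\<in>binding g m i zs. (g i j z)\<^sup>2)"
    by (rule sum_mono) (auto simp: max_def)
  finally show ?thesis .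
qed

theorem mainTheorem7:
  fixes f :: "real ^ 'n::finite \<Rightarrow> real ^ 'm::finite \<Rightarrow> real ^ 'n"
    and x0 :: "real ^ 'n" and Uhard :: "(real ^ 'm) set"
    and stage :: "real ^ 'n \<Rightarrow> real ^ 'm \<Rightarrow> real" and final :: "real ^ 'n \<Rightarrow> real"
    and Z :: "('n, 'm, 'N::finite) trajectory set"
    and J :: "('n, 'm, 'N) trajectory \<Rightarrow> real"
    and m :: "'l::{finite,linorder} \<Rightarrow> nat"
    and g :: "'l \<Rightarrow> nat \<Rightarrow> ('n, 'm, 'N) trajectory \<Rightarrow> real"
    and V :: "'l \<Rightarrow> ('n, 'm, 'N) trajectory \<Rightarrow> real"
    and zs :: "('n, 'm, 'N) trajectory"
    and h :: "nat \<Rightarrow> ('n, 'm, 'N) trajectory \<Rightarrow> real" and A :: "nat set"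
    and i :: 'l and B :: "nat set"
    and K :: "((real, 'l) vec) set"
    and lam :: "(real, 'l) vec \<Rightarrow> nat \<Rightarrow> real"
    and \<eta>\<^sub>0 :: real
    and zp :: "(real, 'l) vec \<Rightarrow> real \<Rightarrow> ('n, 'm, 'N) trajectory"
    and lp :: "(real, 'l) vec \<Rightarrow> real \<Rightarrow> nat \<Rightarrow> real"
    and zloc :: "real \<Rightarrow> (real, 'l) vec \<Rightarrow> ('n, 'm, 'N) trajectory"
    and eps :: "'l \<Rightarrow> real"
  defines "Z \<equiv> dynamics_feasible f x0 Uhard"
    and "J \<equiv> performance stage final"
    and "V \<equiv> violation g m"
    and "B \<equiv> binding g m i zs"
  assumes V_C1: "\<And>i'. C1 (V i')"
    and Z_compact: "compact Z"
    and cascade_attained: "\<And>i'. argmin_on (V i') (cascade V Z {..<i'}) \<noteq> {}"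
    and lex_attained: "argmin_on J (cascade V Z UNIV) \<noteq> {}"
    and weighted_attained: "\<And>w. (\<forall>i'. 0 < w $ i') \<Longrightarrow> argmin_on (weighted_sum J V w) Z \<noteq> {}"
    and lex_unique: "argmin_on J (cascade V Z UNIV) = {zs}"
    and Z_convex: "convex Z"
    and g_convex: "\<And>i' j. j \<in> {1..m i'} \<Longrightarrow> convex_on UNIV (g i' j)"
    and J_convex: "convex_on UNIV J"
    and level_ok: "V i zs = 0"
    and K_compact: "compact K"
    and K_pos: "K \<subseteq> other_weights i"
    and hard: "active_hard Z h A zs"
    and g_C2: "\<exists>U. open U \<and> zs \<in> U \<and> (\<forall>j\<in>B. C2_along (g i j) U)"
    and eta0: "0 < \<eta>\<^sub>0"
    and path: "\<And>w. w \<in> K \<Longrightarrow> solution_path (Psi J V i w) (g i) B h A zs (lam w) \<eta>\<^sub>0 (zp w) (lp w)"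
    and sign_classes: "\<And>w. w \<in> K \<Longrightarrow> stable_signs g m i (Psi J V i w) zs \<eta>\<^sub>0 (zp w)"
    and licq: "joint_LICQ (g i) B h A zs"
    and limit_regular: "\<And>w. w \<in> K \<Longrightarrow> regular_limit Z (Psi J V i w) (g i) B h A zs (lam w)"
    and branch: "local_branch (penalised J V i) (active_manifold Z h A) K zs \<eta>\<^sub>0 zp zloc"
    and eps_pos: "\<And>i'. 0 < eps i'"
    and margin: "\<exists>\<delta>>0. \<forall>i'. 0 < V i' zs \<longrightarrow> \<delta> \<le> \<bar>V i' zs - eps i'\<bar>"
  shows "\<exists>Cg CV wbar. 0 \<le> Cg \<and> 0 \<le> CV \<and> 0 < wbar \<and>
    (\<forall>w\<in>K. \<forall>wi\<ge>wbar.
       max_norm (\<lambda>j. g i j (zloc wi w)) B \<le> max_norm (lam w) B / (2 * wi) + Cg / wi ^ 2 \<and>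
       V i (zloc wi w) \<le> (L2_set (lam w) B)\<^sup>2 / (4 * wi ^ 2) + CV / wi ^ 3) \<and>
    (\<forall>w\<in>K. \<forall>e>0. \<forall>wi.
       (raw_threshold wbar Cg (lam w) B e \<le> wi \<longrightarrow> (\<forall>j\<in>B. \<bar>g i j (zloc wi w)\<bar> \<le> e)) \<and>
       (violation_threshold wbar CV (lam w) B e \<le> wi \<longrightarrow> V i (zloc wi w) \<le> e)) \<and>
    (B \<noteq> {} \<longrightarrow> (\<forall>w\<in>K.
       (\<lambda>e. raw_threshold wbar Cg (lam w) B e) \<in> \<Theta>[at_right 0](\<lambda>e. 1 / e) \<and>
       (\<lambda>e. violation_threshold wbar CV (lam w) B e) \<in> \<Theta>[at_right 0](\<lambda>e. e powr (- (1 / 2)))))"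
proof -
  have finB: "finite B" by (simp add: B_def binding_def)
  have finA: "finite A" using hard by (simp add: active_hard_def)
  from g_C2 obtain U\<^sub>1 where U1: "open U\<^sub>1" "zs \<in> U\<^sub>1" "\<forall>j\<in>B. C2_along (g i j) U\<^sub>1" by blast
  from hard obtain W where W: "open W" "zs \<in> W" "\<forall>l\<in>A. C2_along (h l) W"
    unfolding active_hard_def by blast
  obtain C \<eta>\<^sub>1 \<Lambda> where C: "0 < C" and \<eta>1: "0 < \<eta>\<^sub>1" "\<eta>\<^sub>1 \<le> \<eta>\<^sub>0" and \<Lambda>: "0 \<le> \<Lambda>"
    and zp_close: "\<forall>w\<in>K. \<forall>\<eta>\<in>{0..\<eta>\<^sub>1}. norm (zp w \<eta> - zs) \<le> C * \<eta>"
    and lp_close: "\<forall>w\<in>K. \<forall>\<eta>\<in>{0..\<eta>\<^sub>1}. (\<Sum>j\<in>B. \<bar>lp w \<eta> j - lam w j\<bar>) \<le> C * \<eta>"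
    and lam_bound: "\<forall>w\<in>K. \<forall>j\<in>B. \<bar>lam w j\<bar> \<le> \<Lambda>"
  proof (rule solution_path_estimate[where J = J and V = V and i = i and c = "g i" and h = h
        and K = K and B = B and A = A and U = "U\<^sub>1 \<inter> W" and zs = zs and Z = Z
        and lam = lam and zp = zp and lp = lp and \<eta>\<^sub>0 = \<eta>\<^sub>0])
    show "V i' differentiable (at z)" for i' z using V_C1[of i'] unfolding C1_def by blast
    show "compact K" "finite B" "finite A" "0 < \<eta>\<^sub>0" by fact+
    show "open (U\<^sub>1 \<inter> W)" "zs \<in> U\<^sub>1 \<inter> W" using U1 W by auto
    show "C2_along (g i j) (U\<^sub>1 \<inter> W)" if "j \<in> B" for j
      by (rule C2_along_subset[of _ U\<^sub>1]) (use U1 that in auto)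
    show "C2_along (h l) (U\<^sub>1 \<inter> W)" if "l \<in> A" for l
      by (rule C2_along_subset[of _ W]) (use W that in auto)
    show "g i j zs = 0" if "j \<in> B" for j using that by (simp add: B_def binding_def)
    show "h l zs = 0" if "l \<in> A" for l using that hard by (simp add: active_hard_def)
    show "joint_LICQ (g i) B h A zs" by fact
    show "solution_path (Psi J V i w) (g i) B h A zs (lam w) \<eta>\<^sub>0 (zp w) (lp w)" if "w \<in> K" for w
      by (rule path[OF that])
    show "\<exists>U. open U \<and> zs \<in> U \<and> C2_along (Psi J V i w) (U \<inter> zp w ` {0..\<eta>\<^sub>0})" if "w \<in> K" for w
      using sign_classes[OF that] unfolding stable_signs_def by blast
    show "regular_limit Z (Psi J V i w) (g i) B h A zs (lam w)" if "w \<in> K" for w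
      by (rule limit_regular[OF that])
  qed blast

  \<comment> \<open>a neighbourhood that does not depend on \<open>w\<close>, in contrast to the one in the sign condition\<close>
  have "\<forall>\<^sub>F z in nhds zs. \<forall>j\<in>{1..m i} - B. g i j z < 0"
  proof (intro eventually_ball_finite ballI)
    fix j assume j: "j \<in> {1..m i} - B"
    then have "g i j zs \<le> 0" using level_ok by (auto simp: V_def violation_eq_0_iff)
    moreover have "g i j zs \<noteq> 0" using j by (auto simp: B_def binding_def)
    ultimately have "g i j zs < 0" by simp
    moreover have "continuous_on UNIV (g i j)"
      using j by (intro convex_on_continuous g_convex) auto
    then have "isCont (g i j) zs" using continuous_on_eq_continuous_at open_UNIV by blast
    then have "(g i j \<longlongrightarrow> g i j zs) (nhds zs)" by (simp add: isCont_def tendsto_nhds_iff)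
    ultimately show "\<forall>\<^sub>F z in nhds zs. g i j z < 0" by (rule order_tendstoD(2)[rotated])
  qed simp
  then obtain r where r: "0 < r" "\<And>z j. dist z zs < r \<Longrightarrow> j \<in> {1..m i} - B \<Longrightarrow> g i j z < 0"
    unfolding eventually_nhds_metric by blast

  \<comment> \<open>small enough to keep the path where the non-binding constraints of level \<open>i\<close> are negative\<close>
  define \<eta>\<^sub>2 where "\<eta>\<^sub>2 = min \<eta>\<^sub>1 (r / (2 * C))"
  have \<eta>2: "0 < \<eta>\<^sub>2" "\<eta>\<^sub>2 \<le> \<eta>\<^sub>1" "C * \<eta>\<^sub>2 < r"
  proof -
    show "0 < \<eta>\<^sub>2" "\<eta>\<^sub>2 \<le> \<eta>\<^sub>1" using \<eta>1 r C by (auto simp: \<eta>\<^sub>2_def)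
    have "\<eta>\<^sub>2 \<le> r / (2 * C)" by (simp add: \<eta>\<^sub>2_def)
    then have "2 * (C * \<eta>\<^sub>2) \<le> r" using C by (simp add: field_simps)
    then show "C * \<eta>\<^sub>2 < r" using r by simp
  qed
  define wbar where "wbar = 1 / \<eta>\<^sub>2"
  \<comment> \<open>coefficients of the first correction in \<open>\<eta> / 2 * (\<lambda> + C * \<eta>)\<close> and in
     \<open>\<eta>\<^sup>2 / 4 * (\<lambda>\<^sup>2 + 2 * \<Lambda> * C * \<eta> + C\<^sup>2 * \<eta>\<^sup>2)\<close>, where one \<open>\<eta>\<close> of the last term is replaced by its bound \<open>\<eta>\<^sub>2\<close>\<close>
  define Cg where "Cg = C / 2"
  define CV where "CV = (2 * \<Lambda> * C + C\<^sup>2 * \<eta>\<^sub>2) / 4"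
  have wbar: "0 < wbar" using \<eta>2 by (simp add: wbar_def)
  have Cg: "0 \<le> Cg" using C by (simp add: Cg_def)
  have CV: "0 \<le> CV" using C \<Lambda> \<eta>2 by (simp add: CV_def)

  have rates: "max_norm (\<lambda>j. g i j (zloc wi w)) B \<le> max_norm (lam w) B / (2 * wi) + Cg / wi ^ 2"
      "V i (zloc wi w) \<le> (L2_set (lam w) B)\<^sup>2 / (4 * wi ^ 2) + CV / wi ^ 3"
    if w: "w \<in> K" and wi: "wbar \<le> wi" for w wi
  proof -
    define \<eta> where "\<eta> = 1 / wi"
    have wi0: "0 < wi" using wi wbar by simp
    have \<eta>0': "0 < \<eta>" and \<eta>le: "\<eta> \<le> \<eta>\<^sub>2"
      using wi wi0 \<eta>2(1) by (auto simp: \<eta>_def wbar_def field_simps)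
    have \<eta>: "\<eta> \<in> {0..\<eta>\<^sub>1}" "\<eta> \<in> {0..\<eta>\<^sub>0}" using \<eta>0' \<eta>le \<eta>2 \<eta>1 by auto
    have "1 / \<eta>\<^sub>0 \<le> wi" using \<eta>(2) eta0 wi0 by (auto simp: \<eta>_def field_simps)
    then have zl: "zloc wi w = zp w \<eta>"
      using branch w unfolding local_branch_def \<eta>_def by blast
    have g_eq: "g i j (zp w \<eta>) = \<eta> / 2 * lp w \<eta> j" if "j \<in> B" for j
      using path[OF w] \<eta>(2) that unfolding solution_path_def by blast
    have s: "(\<Sum>j\<in>B. \<bar>lp w \<eta> j - lam w j\<bar>) \<le> C * \<eta>" using lp_close w \<eta>(1) by blast
    show "max_norm (\<lambda>j. g i j (zloc wi w)) B \<le> max_norm (lam w) B / (2 * wi) + Cg / wi ^ 2"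
      unfolding max_norm_le_iff[OF finB]
    proof (intro conjI ballI)
      have mn: "0 \<le> max_norm (lam w) B" "\<forall>j\<in>B. \<bar>lam w j\<bar> \<le> max_norm (lam w) B"
        using max_norm_le_iff[OF finB, of "lam w" "max_norm (lam w) B"] by simp_all
      show "0 \<le> max_norm (lam w) B / (2 * wi) + Cg / wi ^ 2" using mn wi0 Cg by simp
      fix j assume j: "j \<in> B"
      have "\<bar>lp w \<eta> j - lam w j\<bar> \<le> (\<Sum>j\<in>B. \<bar>lp w \<eta> j - lam w j\<bar>)"
        by (rule member_le_sum[OF j]) (use finB in auto)
      then have "\<bar>lp w \<eta> j\<bar> \<le> max_norm (lam w) B + C * \<eta>" using s mn(2) j by fastforce
      then have "\<eta> / 2 * \<bar>lp w \<eta> j\<bar> \<le> \<eta> / 2 * (max_norm (lam w) B + C * \<eta>)"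
        using \<eta>0' by (intro mult_left_mono) auto
      also have "\<dots> = max_norm (lam w) B / (2 * wi) + Cg / wi ^ 2"
        using wi0 by (simp add: \<eta>_def Cg_def power2_eq_square field_simps)
      finally show "\<bar>g i j (zloc wi w)\<bar> \<le> max_norm (lam w) B / (2 * wi) + Cg / wi ^ 2"
        using \<eta>0' by (simp add: zl g_eq[OF j] abs_mult)
    qed
    have "norm (zp w \<eta> - zs) \<le> C * \<eta>" using zp_close w \<eta>(1) by blast
    also have "\<dots> \<le> C * \<eta>\<^sub>2" using \<eta>le C by simp
    finally have "dist (zp w \<eta>) zs < r" using \<eta>2(3) by (simp add: dist_norm)
    then have "V i (zp w \<eta>) \<le> (\<Sum>j\<in>B. (g i j (zp w \<eta>))\<^sup>2)"
      unfolding V_def B_def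
      by (intro violation_le_binding less_imp_le r(2)) (auto simp: B_def)
    also have "\<dots> = \<eta>\<^sup>2 / 4 * (\<Sum>j\<in>B. (lp w \<eta> j)\<^sup>2)"
      unfolding sum_distrib_left
      by (rule sum.cong) (auto simp: g_eq power_mult_distrib power_divide)
    also have "\<dots> \<le> \<eta>\<^sup>2 / 4 * ((L2_set (lam w) B)\<^sup>2 + 2 * \<Lambda> * (C * \<eta>) + (C * \<eta>)\<^sup>2)"
      using sum_squares_perturbation[OF finB \<Lambda> _ s] lam_bound w
      by (intro mult_left_mono) auto
    also have "\<dots> \<le> \<eta>\<^sup>2 / 4 * ((L2_set (lam w) B)\<^sup>2 + (2 * \<Lambda> * C + C\<^sup>2 * \<eta>\<^sub>2) * \<eta>)"
    proof (intro mult_left_mono)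
      have "C\<^sup>2 * \<eta> * \<eta> \<le> C\<^sup>2 * \<eta>\<^sub>2 * \<eta>" using \<eta>le \<eta>0' by (intro mult_right_mono mult_left_mono) auto
      then show "(L2_set (lam w) B)\<^sup>2 + 2 * \<Lambda> * (C * \<eta>) + (C * \<eta>)\<^sup>2
          \<le> (L2_set (lam w) B)\<^sup>2 + (2 * \<Lambda> * C + C\<^sup>2 * \<eta>\<^sub>2) * \<eta>"
        by (simp add: power2_eq_square algebra_simps)
    qed simp
    also have "\<dots> = (L2_set (lam w) B)\<^sup>2 / (4 * wi ^ 2) + CV / wi ^ 3"
      using wi0 by (simp add: \<eta>_def CV_def power2_eq_square power3_eq_cube field_simps)
    finally show "V i (zloc wi w) \<le> (L2_set (lam w) B)\<^sup>2 / (4 * wi ^ 2) + CV / wi ^ 3"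
      unfolding zl .
  qed
  have lam_pos: "\<forall>j\<in>B. 0 < lam w j" if "w \<in> K" for w
    using limit_regular[OF that] by (simp add: regular_limit_def)

  show ?thesis
  proof (rule exI[of _ Cg], rule exI[of _ CV], rule exI[of _ wbar],
      intro conjI ballI allI impI)
    show "0 \<le> Cg" "0 \<le> CV" "0 < wbar" by fact+
  next
    fix w wi assume "w \<in> K" "wbar \<le> wi"
    then show "max_norm (\<lambda>j. g i j (zloc wi w)) B \<le> max_norm (lam w) B / (2 * wi) + Cg / wi ^ 2"
      and "V i (zloc wi w) \<le> (L2_set (lam w) B)\<^sup>2 / (4 * wi ^ 2) + CV / wi ^ 3"
      by (fact rates)+
  next
    fix w e wi j
    assume w: "w \<in> K" and e: "(0::real) < e" and thr: "raw_threshold wbar Cg (lam w) B e \<le> wi"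
      and j: "j \<in> B"
    note suff = raw_threshold_sufficient[OF e wbar thr]
    have "max_norm (\<lambda>j. g i j (zloc wi w)) B \<le> e" using rates(1)[OF w suff(1)] suff(2) by linarith
    then show "\<bar>g i j (zloc wi w)\<bar> \<le> e" using j by (simp add: max_norm_le_iff[OF finB])
  next
    fix w e wi
    assume w: "w \<in> K" and e: "(0::real) < e" and thr: "violation_threshold wbar CV (lam w) B e \<le> wi"
    note suff = violation_threshold_sufficient[OF e wbar CV thr]
    show "V i (zloc wi w) \<le> e" using rates(2)[OF w suff(1)] suff(2) by linarith
  next
    fix w assume "B \<noteq> {}" "w \<in> K"
    then show "(\<lambda>e. raw_threshold wbar Cg (lam w) B e) \<in> \<Theta>[at_right 0](\<lambda>e. 1 / e)"
      and "(\<lambda>e. violation_threshold wbar CV (lam w) B e) \<in> \<Theta>[at_right 0](\<lambda>e. e powr (- (1 / 2)))"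
      using raw_threshold_bigtheta[OF finB _ lam_pos wbar Cg]
        violation_threshold_bigtheta[OF finB _ lam_pos wbar CV] by auto
  qed
qed

end
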